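(* Let $0\le\underline\sigma\le\overline\sigma$ and let $X\sim N(0,[\underline\sigma^2,\overline\sigma^2])$ be a $G$-normally distributed random variable on a sublinear expectation space $(\Omega,\mathcal H,\hat{\mathbb E})$. Let $\varphi\in C_{l.Lip}(\mathbb R)$. For each integer $n\ge1$ define functions $\varphi_{i,n}:\mathbb R\to\mathbb R$, $i=0,1,\dots,n$, by $\varphi_{0,n}(x):=\varphi(x)$ and $$\varphi_{i+1,n}(x):=\max_{v\in[\underline\sigma,\overline\sigma]}E\big[\varphi_{i,n}\big(N(x,v^2/n)\big)\big],\qquad i=0,1,\dots,n-1 .$$ Then $\varphi_{n,n}(0)\to\hat{\mathbb E}[\varphi(X)]$ as $n\to\infty$.
   Context: $C_{l.Lip}(\mathbb R^d)$ is the space of functions $\varphi:\mathbb R^d\to\mathbb R$ for which there are $C_\varphi>0$ and $k\in\mathbb N$ with $|\varphi(x)-\varphi(y)|\le C_\varphi(1+|x|^k+|y|^k)|x-y|$ for all $x,y$. Sublinear expectation space $(\Omega,\mathcal H,\hat{\mathbb E})$: $\Omega$ is a set; $\mathcal H$ is a linear space of real functions on $\Omega$ containing the constants, with $|X|\in\mathcal H$ whenever $X\in\mathcal H$, and with $\varphi(X_1,\dots,X_d)\in\mathcal H$ whenever $X_1,\dots,X_d\in\mathcal H$ and $\varphi\in C_{l.Lip}(\mathbb R^d)$; $\hat{\mathbb E}:\mathcal H\to\mathbb R$ satisfies monotonicity, constant preservation, sub-additivity ($\hat{\mathbb E}[X+Y]\le\hat{\mathbb E}[X]+\hat{\mathbb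 E}[Y]$) and positive homogeneity ($\hat{\mathbb E}[\lambda X]=\lambda\hat{\mathbb E}[X]$ for $\lambda\ge0$). $G$-normal distribution: $X\sim N(0,[\underline\sigma^2,\overline\sigma^2])$ means that for every $\varphi\in C_{l.Lip}(\mathbb R)$ the function $u(t,x):=\hat{\mathbb E}[\varphi(x+\sqrt{1-t}\,X)]$, $(t,x)\in[0,1]\times\mathbb R$, is the (unique viscosity, of polynomial growth) solution of the $G$-heat equation $u_t+G(u_{xx})=0$, $u|_{t=1}=\varphi$, where $G(a)=\frac12\hat{\mathbb E}[aX^2]=\frac12(\overline\sigma^2a^+-\underline\sigma^2a^-)$, $a^+=\max\{a,0\}$, $a^-=\max\{-a,0\}$. In particular $\hat{\mathbb E}[\varphi(X)]=u(0,0)$. $E$ denotes the classical linear expectation, and $E[\psi(N(\mu,s^2))]$ denotes the expectation of $\psi$ of a classical normal random variable with mean $\mu$ and variance $s^2$ (point mass at $\mu$ if $s=0$). *)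

theory Defs
  imports "HOL-Probability.Probability"
begin

definition C_lLip :: "(real \<Rightarrow> real) set" where
  "C_lLip = {\<phi>. \<exists>C>0. \<exists>k::nat. \<forall>x y.
      \<bar>\<phi> x - \<phi> y\<bar> \<le> C * (1 + \<bar>x\<bar> ^ k + \<bar>y\<bar> ^ k) * \<bar>x - y\<bar>}"

text \<open>
  The space of locally Lipschitz functions on the Euclidean space of dimension d, for a
  dimension d that can be quantified over.  Points are functions on the natural numbers of which
  only the first d values matter: the estimate, taken for all x and y, forces \<phi> x = \<phi> y whenever
  x and y agree below d, so these are exactly the functions on d-dimensional space.
\<close>

definition C_lLip_dim :: "nat \<Rightarrow> ((nat \<Rightarrow> real) \<Rightarrow> real) set" where
  "C_lLip_dim d = {\<phi>. \<exists>C>0. \<exists>k::nat. \<forall>x y.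
      \<bar>\<phi> x - \<phi> y\<bar> \<le>
        C * (1 + L2_set x {..<d} ^ k + L2_set y {..<d} ^ k) * L2_set (\<lambda>i. x i - y i) {..<d}}"

lemma C_lLip_dim_1: "(\<lambda>x. \<phi> (x 0)) \<in> C_lLip_dim 1 \<longleftrightarrow> \<phi> \<in> C_lLip"
proof -
  have norm1: "L2_set x {..<1::nat} = \<bar>x 0\<bar>" for x :: "nat \<Rightarrow> real"
    by (simp add: L2_set_def lessThan_Suc)
  have eq: "(\<forall>x y :: nat \<Rightarrow> real. P (x 0) (y 0)) \<longleftrightarrow> (\<forall>a b. P a b)" for P :: "real \<Rightarrow> real \<Rightarrow> bool"
  proof
    assume *: "\<forall>x y :: nat \<Rightarrow> real. P (x 0) (y 0)"
    show "\<forall>a b. P a b"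
    proof (intro allI)
      show "P a b" for a b
        using *[rule_format, of "\<lambda>_. a" "\<lambda>_. b"] by simp
    qed
  qed simp
  show ?thesis
    unfolding C_lLip_dim_def C_lLip_def norm1 mem_Collect_eq
    by (subst eq) (rule refl)
qed

text \<open>
  The underlying set of outcomes is the type 'w.  The functional \<E> is only constrained on \<H>.
\<close>

locale sublinear_expectation_space =
  fixes \<H> :: "('w \<Rightarrow> real) set" and \<E> :: "('w \<Rightarrow> real) \<Rightarrow> real"
  assumes const_mem: "(\<lambda>_. c) \<in> \<H>"
    and add_mem: "X \<in> \<H> \<Longrightarrow> Y \<in> \<H> \<Longrightarrow> (\<lambda>\<omega>. X \<omega> + Y \<omega>) \<in> \<H>"
    and scale_mem: "X \<in> \<H> \<Longrightarrow> (\<lambda>\<omega>. c * X \<omega>) \<in> \<H>"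
    and abs_mem: "X \<in> \<H> \<Longrightarrow> (\<lambda>\<omega>. \<bar>X \<omega>\<bar>) \<in> \<H>"
    and lLip_mem: "(\<And>i. i < d \<Longrightarrow> Xs i \<in> \<H>) \<Longrightarrow> \<phi> \<in> C_lLip_dim d \<Longrightarrow>
      (\<lambda>\<omega>. \<phi> (\<lambda>i. Xs i \<omega>)) \<in> \<H>"
    and mono: "X \<in> \<H> \<Longrightarrow> Y \<in> \<H> \<Longrightarrow> (\<And>\<omega>. X \<omega> \<le> Y \<omega>) \<Longrightarrow> \<E> X \<le> \<E> Y"
    and const: "\<E> (\<lambda>_. c) = c"
    and subadd: "X \<in> \<H> \<Longrightarrow> Y \<in> \<H> \<Longrightarrow> \<E> (\<lambda>\<omega>. X \<omega> + Y \<omega>) \<le> \<E> X + \<E> Y"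
    and pos_homog: "X \<in> \<H> \<Longrightarrow> 0 \<le> l \<Longrightarrow> \<E> (\<lambda>\<omega>. l * X \<omega>) = l * \<E> X"

definition G_fun :: "real \<Rightarrow> real \<Rightarrow> real \<Rightarrow> real" where
  "G_fun \<sigma>l \<sigma>u a = (\<sigma>u\<^sup>2 * max a 0 - \<sigma>l\<^sup>2 * max (- a) 0) / 2"

definition C12_on ::
  "(real \<times> real) set \<Rightarrow> (real \<Rightarrow> real \<Rightarrow> real) \<Rightarrow> (real \<Rightarrow> real \<Rightarrow> real) \<Rightarrow>
   (real \<Rightarrow> real \<Rightarrow> real) \<Rightarrow> (real \<Rightarrow> real \<Rightarrow> real) \<Rightarrow> bool" where
  "C12_on U \<psi> \<psi>t \<psi>x \<psi>xx \<longleftrightarrow>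
     (\<forall>(t, x)\<in>U. ((\<lambda>s. \<psi> s x) has_real_derivative \<psi>t t x) (at t) \<and>
                ((\<lambda>y. \<psi> t y) has_real_derivative \<psi>x t x) (at x) \<and>
                ((\<lambda>y. \<psi>x t y) has_real_derivative \<psi>xx t x) (at x)) \<and>
     continuous_on U (\<lambda>(t, x). \<psi> t x) \<and> continuous_on U (\<lambda>(t, x). \<psi>t t x) \<and>
     continuous_on U (\<lambda>(t, x). \<psi>x t x) \<and> continuous_on U (\<lambda>(t, x). \<psi>xx t x)"

text \<open>
  Viscosity sub- and supersolutions of u_t + G(u_xx) = 0 in the open strip, tested at local
  extrema of u - \<psi>.  The equation runs backwards in time from a terminal condition at time 1, so
  a smooth subsolution satisfies u_t + G(u_xx) \<ge> 0.
\<close>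

definition viscosity_subsolution :: "(real \<Rightarrow> real) \<Rightarrow> (real \<Rightarrow> real \<Rightarrow> real) \<Rightarrow> bool" where
  "viscosity_subsolution G u \<longleftrightarrow>
     (\<forall>U \<psi> \<psi>t \<psi>x \<psi>xx t x.
        open U \<and> U \<subseteq> {0<..<1} \<times> UNIV \<and> (t, x) \<in> U \<and> C12_on U \<psi> \<psi>t \<psi>x \<psi>xx \<and>
        (\<forall>(s, y)\<in>U. u s y - \<psi> s y \<le> u t x - \<psi> t x) \<longrightarrow>
        \<psi>t t x + G (\<psi>xx t x) \<ge> 0)"

definition viscosity_supersolution :: "(real \<Rightarrow> real) \<Rightarrow> (real \<Rightarrow> real \<Rightarrow> real) \<Rightarrow> bool" where
  "viscosity_supersolution G u \<longleftrightarrow>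
     (\<forall>U \<psi> \<psi>t \<psi>x \<psi>xx t x.
        open U \<and> U \<subseteq> {0<..<1} \<times> UNIV \<and> (t, x) \<in> U \<and> C12_on U \<psi> \<psi>t \<psi>x \<psi>xx \<and>
        (\<forall>(s, y)\<in>U. u s y - \<psi> s y \<ge> u t x - \<psi> t x) \<longrightarrow>
        \<psi>t t x + G (\<psi>xx t x) \<le> 0)"

definition polynomial_growth :: "(real \<Rightarrow> real \<Rightarrow> real) \<Rightarrow> bool" where
  "polynomial_growth u \<longleftrightarrow>
     (\<exists>C. \<exists>k::nat. \<forall>t\<in>{0..1}. \<forall>x. \<bar>u t x\<bar> \<le> C * (1 + \<bar>x\<bar> ^ k))"

definition G_heat_solution ::
  "(real \<Rightarrow> real) \<Rightarrow> (real \<Rightarrow> real) \<Rightarrow> (real \<Rightarrow> real \<Rightarrow> real) \<Rightarrow> bool" where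
  "G_heat_solution G \<phi> u \<longleftrightarrow>
     continuous_on ({0..1} \<times> UNIV) (\<lambda>(t, x). u t x) \<and> polynomial_growth u \<and>
     viscosity_subsolution G u \<and> viscosity_supersolution G u \<and>
     (\<forall>x. u 1 x = \<phi> x)"

text \<open>
  X is G-normal, with lower and upper standard deviations \<sigma>l and \<sigma>u.  Uniqueness of the solution
  of the G-heat equation is a theorem and not part of the definition.
\<close>

definition G_normal ::
  "('w \<Rightarrow> real) set \<Rightarrow> (('w \<Rightarrow> real) \<Rightarrow> real) \<Rightarrow> real \<Rightarrow> real \<Rightarrow> ('w \<Rightarrow> real) \<Rightarrow> bool" where
  "G_normal \<H> \<E> \<sigma>l \<sigma>u X \<longleftrightarrow>
     X \<in> \<H> \<and>
     (\<forall>a. G_fun \<sigma>l \<sigma>u a = \<E> (\<lambda>\<omega>. a * (X \<omega>)\<^sup>2) / 2) \<and>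
     (\<forall>\<phi>\<in>C_lLip. G_heat_solution (G_fun \<sigma>l \<sigma>u) \<phi>
        (\<lambda>t x. \<E> (\<lambda>\<omega>. \<phi> (x + sqrt (1 - t) * X \<omega>))))"

text \<open>
  The classical normal law, parametrised by mean and variance; the library density is
  parametrised by the standard deviation.
\<close>

definition normal_law :: "real \<Rightarrow> real \<Rightarrow> real measure" where
  "normal_law m var =
     (if var = 0 then return borel m else density lborel (normal_density m (sqrt var)))"

text \<open>
  The operator GREATEST denotes a genuine maximum: it has a specified value only where the
  maximum over v is attained.
\<close>

primrec phi_scheme :: "real \<Rightarrow> real \<Rightarrow> (real \<Rightarrow> real) \<Rightarrow> nat \<Rightarrow> nat \<Rightarrow> real \<Rightarrow> real" where
  "phi_scheme \<sigma>l \<sigma>u \<phi> n 0 = \<phi>"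
| "phi_scheme \<sigma>l \<sigma>u \<phi> n (Suc i) =
     (\<lambda>x. GREATEST m. m \<in>
        (\<lambda>v. \<integral>y. phi_scheme \<sigma>l \<sigma>u \<phi> n i y \<partial>normal_law x (v\<^sup>2 / real n)) ` {\<sigma>l..\<sigma>u})"

end

(*
  Write u(t,x) for the viscosity solution and S for one step of the scheme.

  Lower bound: u is a supersolution of the heat equation for each constant volatility in
  [sigma_l, sigma_u], so u(t,.) dominates every Gaussian average of u(t + 1/n,.), hence S u(t + 1/n,.).
  By induction the scheme stays below u for every n.

  Upper bound: the iterates v_k of the scheme satisfy v_{k+1} >= P v_k for every admissible
  Gaussian average P.  These inequalities are linear, so they survive mollification in x;
  interpolating the mollified iterates linearly in time gives a smooth function which, by Taylor
  expansion, is a supersolution of the G-heat equation up to an error of order n^{-1/2} for a fixed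
  mollification width.  Comparing u with a smooth function needs only the definition of a
  viscosity solution, so no comparison principle between viscosity solutions is required.

  Both bounds are shown for bounded Lipschitz data; general data are truncated.
*)

theory Submission
  imports Defs
begin

text \<open>The mollification width \<epsilon> and the number n of steps pull against each other:
  exchanging a Lipschitz function for its mollification costs 2 * L * \<epsilon>, while the
  consistency error per unit of time is of order L / \<epsilon>^2 * n^(-1/2). The estimate closes
  because the first cost is paid only at the two ends of the chain and not at every step, so
  \<epsilon> can be fixed before n tends to infinity. For this, B and L must be the same for all
  iterates and all n; averaging and taking maxima preserve both.

  That u dominates each Gaussian average is proved by the same chain argument as the upper bound,
  applied to -u and a single volatility.

  Truncation needs a weight on each side. The scheme is controlled by exp x + exp (- x), which a
  Gaussian average merely multiplies by a constant. This function lies outside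
  \<open>C_lLip\<close>, so its composition with X need not lie in \<open>\<H>\<close>; there the
  polynomial weight |x|^2 + 2 * |x|^(k + 2) takes its place.\<close>

section \<open>Gaussian averages and the scheme\<close>

text \<open>The law \<open>M\<close> stays fixed and the scale \<open>s\<close> sits in the
  argument, so that Gaussians of all variances, including the point mass at \<open>s = 0\<close>,
  are integrals against one measure. The same operator with a uniform law is the mollifier.\<close>

definition avg :: "real measure \<Rightarrow> real \<Rightarrow> (real \<Rightarrow> real) \<Rightarrow> real \<Rightarrow> real" where
  "avg M s f x = (LINT z|M. f (x + s * z))"

text \<open>The exponential weight factorizes under a shift, exp |x + s z| \<le> exp |x| * exp (|s|
  |z|), so a Gaussian average stays in the class with a new constant. The class makes the scheme
  well defined for the original, untruncated data.\<close>

definition exp_lip :: "real \<Rightarrow> (real \<Rightarrow> real) \<Rightarrow> bool" where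
  "exp_lip C f \<longleftrightarrow> (\<forall>x y. \<bar>f x - f y\<bar> \<le> C * (exp \<bar>x\<bar> + exp \<bar>y\<bar>) * \<bar>x - y\<bar>)"

lemma exp_lipD: "exp_lip C f \<Longrightarrow> \<bar>f x - f y\<bar> \<le> C * (exp \<bar>x\<bar> + exp \<bar>y\<bar>) * \<bar>x - y\<bar>"
  by (simp add: exp_lip_def)

lemma exp_lip_nonneg:
  assumes "exp_lip C f" shows "0 \<le> C"
proof -
  have "0 \<le> C * (exp \<bar>1\<bar> + exp \<bar>0\<bar>) * \<bar>1 - 0 :: real\<bar>"
    using exp_lipD[OF assms, of 1 0] by (rule order_trans[OF abs_ge_zero])
  moreover have "0 < exp 1 + (1::real)" by (simp add: add_pos_pos)
  ultimately show ?thesis by (auto simp: zero_le_mult_iff)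
qed

lemma exp_lip_continuous:
  assumes "exp_lip C f" shows "continuous_on UNIV f"
proof -
  have "isCont f x" for x
  proof -
    have "((\<lambda>y. C * (exp \<bar>y\<bar> + exp \<bar>x\<bar>) * \<bar>y - x\<bar>) \<longlongrightarrow> C * (exp \<bar>x\<bar> + exp \<bar>x\<bar>) * \<bar>x - x\<bar>) (at x)"
      by (intro tendsto_intros)
    then have "((\<lambda>y. C * (exp \<bar>y\<bar> + exp \<bar>x\<bar>) * \<bar>y - x\<bar>) \<longlongrightarrow> 0) (at x)"
      by simp
    then have "((\<lambda>y. f y - f x) \<longlongrightarrow> 0) (at x)"
      by (rule Lim_null_comparison[rotated]) (simp add: exp_lipD[OF assms])
    then show ?thesis
      by (simp add: isCont_def LIM_zero_iff)
  qed
  then show ?thesis by (simp add: continuous_on_eq_continuous_at)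
qed

lemma exp_lip_growth:
  assumes "exp_lip C f" shows "\<bar>f x\<bar> \<le> (\<bar>f 0\<bar> + 2 * C) * exp (2 * \<bar>x\<bar>)"
proof -
  have C: "0 \<le> C" by (rule exp_lip_nonneg[OF assms])
  have e: "1 \<le> exp \<bar>x\<bar>" "\<bar>x\<bar> \<le> exp \<bar>x\<bar>" "exp (2 * \<bar>x\<bar>) = exp \<bar>x\<bar> * exp \<bar>x\<bar>" "1 \<le> exp (2*\<bar>x\<bar>)"
    using exp_ge_add_one_self[of "\<bar>x\<bar>"] by (auto simp flip: exp_add simp: order_trans[OF _ exp_ge_add_one_self])
  have "\<bar>f x\<bar> \<le> \<bar>f 0\<bar> + C * (exp \<bar>x\<bar> + exp \<bar>0\<bar>) * \<bar>x - 0\<bar>"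
    using exp_lipD[OF assms, of x 0] by linarith
  also have "C * (exp \<bar>x\<bar> + exp \<bar>0\<bar>) * \<bar>x - 0\<bar> \<le> C * (2 * exp \<bar>x\<bar>) * exp \<bar>x\<bar>"
    using e C by (intro mult_mono) auto
  also have "\<dots> = 2 * C * exp (2 * \<bar>x\<bar>)" using e by simp
  also have "\<bar>f 0\<bar> \<le> \<bar>f 0\<bar> * exp (2 * \<bar>x\<bar>)" using mult_left_mono[OF e(4), of "\<bar>f 0\<bar>"] by simp
  finally show ?thesis by (simp add: algebra_simps)
qed

lemma lipschitz_imp_exp_lip:
  assumes "\<And>x y. \<bar>f x - f y\<bar> \<le> L * \<bar>x - y\<bar>" "0 \<le> L"
  shows "exp_lip L f"
  unfolding exp_lip_def
proof (intro allI)
  fix x y :: real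
  have "1 \<le> exp \<bar>x\<bar> + exp \<bar>y\<bar>" by (simp add: add_increasing2 order_less_imp_le)
  then have "L * 1 \<le> L * (exp \<bar>x\<bar> + exp \<bar>y\<bar>)" using assms(2) by (intro mult_left_mono)
  then show "\<bar>f x - f y\<bar> \<le> L * (exp \<bar>x\<bar> + exp \<bar>y\<bar>) * \<bar>x - y\<bar>"
    using assms(1)[of x y] mult_right_mono[of "L * 1" "L * (exp \<bar>x\<bar> + exp \<bar>y\<bar>)" "\<bar>x - y\<bar>"] by simp
qed

lemma power_le_exp: "0 \<le> x \<Longrightarrow> x ^ k \<le> fact k * exp (x::real)"
proof -
  assume x: "0 \<le> x"
  have "(\<Sum>i\<in>{k}. x ^ i /\<^sub>R fact i) \<le> (\<Sum>i. x ^ i /\<^sub>R fact i)"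
    using x by (intro sum_le_suminf summable_exp_generic) auto
  then show ?thesis by (simp add: exp_def field_simps)
qed

lemma C_lLip_exp_lip:
  assumes "\<phi> \<in> C_lLip" obtains C where "exp_lip C \<phi>"
proof -
  obtain C k where C: "C > 0" and
    b: "\<And>x y. \<bar>\<phi> x - \<phi> y\<bar> \<le> C * (1 + \<bar>x\<bar> ^ k + \<bar>y\<bar> ^ k) * \<bar>x - y\<bar>"
    using assms by (auto simp: C_lLip_def)
  have "exp_lip (C * (1 + fact k)) \<phi>"
    unfolding exp_lip_def
  proof (intro allI)
    fix x y :: real
    have "1 \<le> exp \<bar>x\<bar> + exp \<bar>y\<bar>" by (simp add: add_increasing2 order_less_imp_le)
    then have "1 + \<bar>x\<bar> ^ k + \<bar>y\<bar> ^ k \<le> (1 + fact k) * (exp \<bar>x\<bar> + exp \<bar>y\<bar>)"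
      using power_le_exp[of "\<bar>x\<bar>" k] power_le_exp[of "\<bar>y\<bar>" k] by (simp add: algebra_simps)
    then have "C * (1 + \<bar>x\<bar> ^ k + \<bar>y\<bar> ^ k) * \<bar>x - y\<bar> \<le> C * ((1 + fact k) * (exp \<bar>x\<bar> + exp \<bar>y\<bar>)) * \<bar>x - y\<bar>"
      using C by (intro mult_right_mono mult_left_mono) auto
    then show "\<bar>\<phi> x - \<phi> y\<bar> \<le> C * (1 + fact k) * (exp \<bar>x\<bar> + exp \<bar>y\<bar>) * \<bar>x - y\<bar>"
      using b[of x y] by (simp add: mult.assoc)
  qed
  then show thesis by (rule that)
qed

section \<open>Exponential moments and Gaussian averages of functions of exponential growth\<close>

interpretation std_normal: real_distribution std_normal_distribution
  by (rule real_dist_normal_dist)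

lemma
  shows std_normal_exp_integrable: "integrable std_normal_distribution (\<lambda>z. exp (a * z))"
    and std_normal_exp_integral: "(LINT z|std_normal_distribution. exp (a * z)) = exp (a\<^sup>2 / 2)"
proof -
  \<comment> \<open>Completing the square: the weight exp (a z) moves the mean of the normal density
    from 0 to a.\<close>
  have eq: "std_normal_density z * exp (a * z) = exp (a\<^sup>2 / 2) * normal_density a 1 z" for z
    by (simp add: normal_density_def field_simps power2_eq_square flip: exp_add)
  have "has_bochner_integral lborel (\<lambda>z. exp (a\<^sup>2 / 2) * normal_density a 1 z) (exp (a\<^sup>2 / 2) * 1)"
    by (intro has_bochner_integral_mult_right) (simp add: has_bochner_integral_iff)
  then have "has_bochner_integral std_normal_distribution (\<lambda>z. exp (a * z)) (exp (a\<^sup>2 / 2))"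
    by (intro has_bochner_integral_density) (auto simp: eq)
  then show "integrable std_normal_distribution (\<lambda>z. exp (a * z))"
    "(LINT z|std_normal_distribution. exp (a * z)) = exp (a\<^sup>2 / 2)"
    by (auto simp: has_bochner_integral_iff)
qed

lemma std_normal_exp_abs_integrable: "integrable std_normal_distribution (\<lambda>z. exp (a * \<bar>z\<bar>))"
proof (rule Bochner_Integration.integrable_bound)
  show "integrable std_normal_distribution (\<lambda>z. exp (a * z) + exp (- a * z))"
    by (intro Bochner_Integration.integrable_add std_normal_exp_integrable)
  have "exp (a * \<bar>z\<bar>) \<le> \<bar>exp (a * z) + exp (- a * z)\<bar>" for z
    by (rule order_trans[OF _ abs_ge_self]) (auto simp: abs_if add_increasing add_increasing2)
  then show "AE z in std_normal_distribution. norm (exp (a * \<bar>z\<bar>)) \<le> norm (exp (a * z) + exp (- a * z))"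
    by (intro AE_I2) simp
qed simp

lemma exp_lip_affine_bound:
  assumes "exp_lip C f" "\<bar>s\<bar> \<le> S"
  shows "\<bar>f (x + s * z)\<bar> \<le> (\<bar>f 0\<bar> + 2 * C) * exp (2 * \<bar>x\<bar>) * exp (2 * S * \<bar>z\<bar>)"
proof -
  have C: "0 \<le> C" by (rule exp_lip_nonneg[OF assms(1)])
  have "\<bar>s * z\<bar> \<le> S * \<bar>z\<bar>" using assms(2) by (simp add: abs_mult mult_right_mono)
  then have "2 * \<bar>x + s * z\<bar> \<le> 2 * \<bar>x\<bar> + 2 * S * \<bar>z\<bar>"
    using abs_triangle_ineq[of x "s * z"] by simp
  then have "exp (2 * \<bar>x + s * z\<bar>) \<le> exp (2 * \<bar>x\<bar>) * exp (2 * S * \<bar>z\<bar>)"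
    by (simp flip: exp_add)
  then have "(\<bar>f 0\<bar> + 2 * C) * exp (2 * \<bar>x + s * z\<bar>) \<le> (\<bar>f 0\<bar> + 2 * C) * (exp (2 * \<bar>x\<bar>) * exp (2 * S * \<bar>z\<bar>))"
    using C by (intro mult_left_mono) auto
  then show ?thesis
    using exp_lip_growth[OF assms(1), of "x + s * z"] by (simp add: mult.assoc)
qed

lemma exp_lip_measurable: "exp_lip C f \<Longrightarrow> f \<in> borel_measurable borel"
  by (intro borel_measurable_continuous_onI exp_lip_continuous)

lemma exp_lip_integrable:
  assumes "exp_lip C f"
  shows "integrable std_normal_distribution (\<lambda>z. f (x + s * z))"
proof (rule Bochner_Integration.integrable_bound)
  show "integrable std_normal_distribution (\<lambda>z. (\<bar>f 0\<bar> + 2 * C) * exp (2 * \<bar>x\<bar>) * exp (2 * \<bar>s\<bar> * \<bar>z\<bar>))"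
    by (intro integrable_mult_right std_normal_exp_abs_integrable)
  have [measurable]: "f \<in> borel_measurable borel" by (rule exp_lip_measurable[OF assms])
  show "(\<lambda>z. f (x + s * z)) \<in> borel_measurable std_normal_distribution" by simp
  show "AE z in std_normal_distribution. norm (f (x + s * z)) \<le>
     norm ((\<bar>f 0\<bar> + 2 * C) * exp (2 * \<bar>x\<bar>) * exp (2 * \<bar>s\<bar> * \<bar>z\<bar>))"
    unfolding real_norm_def by (intro AE_I2 order_trans[OF exp_lip_affine_bound[OF assms order_refl] abs_ge_self])
qed

text \<open>One constant serves all scales up to \<open>S\<close>; this is what survives the maximum
  over volatilities.\<close>

lemma avg_exp_lip:
  assumes "exp_lip C f" "\<bar>s\<bar> \<le> S"
  shows "exp_lip (C * (LINT z|std_normal_distribution. exp (S * \<bar>z\<bar>))) (avg std_normal_distribution s f)"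
  unfolding exp_lip_def
proof (intro allI)
  fix x y :: real
  have C: "0 \<le> C" by (rule exp_lip_nonneg[OF assms(1)])
  have eq: "avg std_normal_distribution s f x - avg std_normal_distribution s f y =
    (LINT z|std_normal_distribution. f (x + s * z) - f (y + s * z))"
    unfolding avg_def
    by (intro Bochner_Integration.integral_diff[symmetric] exp_lip_integrable[OF assms(1)])
  have "\<bar>avg std_normal_distribution s f x - avg std_normal_distribution s f y\<bar> \<le> (LINT z|std_normal_distribution. C * (exp \<bar>x\<bar> + exp \<bar>y\<bar>) * \<bar>x - y\<bar> * exp (S * \<bar>z\<bar>))"
  unfolding eq
  proof (rule integral_abs_bound_integral)
    fix z
    have *: "exp \<bar>w + s * z\<bar> \<le> exp \<bar>w\<bar> * exp (S * \<bar>z\<bar>)" for w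
    proof -
      have "\<bar>s * z\<bar> \<le> S * \<bar>z\<bar>" using assms(2) by (simp add: abs_mult mult_right_mono)
      then show ?thesis by (simp flip: exp_add)
    qed
    have "\<bar>f (x + s * z) - f (y + s * z)\<bar> \<le>
       C * (exp \<bar>x + s * z\<bar> + exp \<bar>y + s * z\<bar>) * \<bar>(x + s * z) - (y + s * z)\<bar>"
      by (rule exp_lipD[OF assms(1)])
    also have "\<dots> \<le> C * (exp \<bar>x\<bar> * exp (S * \<bar>z\<bar>) + exp \<bar>y\<bar> * exp (S * \<bar>z\<bar>)) * \<bar>(x + s * z) - (y + s * z)\<bar>"
      using C by (intro mult_right_mono mult_left_mono add_mono *) auto
    finally show "\<bar>f (x + s * z) - f (y + s * z)\<bar> \<le> C * (exp \<bar>x\<bar> + exp \<bar>y\<bar>) * \<bar>x - y\<bar> * exp (S * \<bar>z\<bar>)"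
      by (simp add: algebra_simps)
  qed (auto intro!: Bochner_Integration.integrable_diff exp_lip_integrable[OF assms(1)] std_normal_exp_abs_integrable)
  also have "\<dots> = C * (exp \<bar>x\<bar> + exp \<bar>y\<bar>) * \<bar>x - y\<bar> * (LINT z|std_normal_distribution. exp (S * \<bar>z\<bar>))"
    by (rule integral_mult_right_zero)
  finally show "\<bar>avg std_normal_distribution s f x - avg std_normal_distribution s f y\<bar> \<le>
    C * (LINT z|std_normal_distribution. exp (S * \<bar>z\<bar>)) * (exp \<bar>x\<bar> + exp \<bar>y\<bar>) * \<bar>x - y\<bar>"
    by (simp only: mult_ac)
qed

text \<open>Needed for the maximum over volatilities to be attained. A convergent sequence of scales
  is bounded, which supplies the integrable envelope for dominated convergence.\<close>

lemma avg_continuous_scale: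
  assumes "exp_lip C f"
  shows "continuous_on A (\<lambda>s. avg std_normal_distribution s f x)"
proof -
  have "(\<lambda>n. avg std_normal_distribution (\<sigma> n) f x) \<longlonglongrightarrow> avg std_normal_distribution s f x"
    if lim: "\<sigma> \<longlonglongrightarrow> s" for \<sigma> :: "nat \<Rightarrow> real" and s
  proof -
    obtain S where S: "\<And>n. \<bar>\<sigma> n\<bar> \<le> S"
      using BseqE[OF convergent_imp_Bseq[OF convergentI[OF lim]]] by auto
    have [measurable]: "f \<in> borel_measurable borel" by (rule exp_lip_measurable[OF assms])
    show ?thesis
      unfolding avg_def
    proof (rule integral_dominated_convergence)
      show "integrable std_normal_distribution (\<lambda>z. (\<bar>f 0\<bar> + 2 * C) * exp (2 * \<bar>x\<bar>) * exp (2 * S * \<bar>z\<bar>))"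
        by (intro integrable_mult_right std_normal_exp_abs_integrable)
      have "isCont f y" for y
        using exp_lip_continuous[OF assms] by (simp add: continuous_on_eq_continuous_at)
      then show "AE z in std_normal_distribution. (\<lambda>n. f (x + \<sigma> n * z)) \<longlonglongrightarrow> f (x + s * z)"
        by (intro AE_I2 isCont_tendsto_compose[where g=f] tendsto_intros lim)
      show "AE z in std_normal_distribution. norm (f (x + \<sigma> n * z)) \<le>
          (\<bar>f 0\<bar> + 2 * C) * exp (2 * \<bar>x\<bar>) * exp (2 * S * \<bar>z\<bar>)" for n
        using exp_lip_affine_bound[OF assms S] by (intro AE_I2) simp
    qed auto
  qed
  then show ?thesis
    by (auto simp: continuous_on_sequentially comp_def)
qed

lemma integral_normal_law:
  assumes "0 \<le> s" and [measurable]: "f \<in> borel_measurable borel"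
  shows "(\<integral>y. f y \<partial>normal_law x (s\<^sup>2)) = avg std_normal_distribution s f x"
proof (cases "s = 0")
  case True
  then show ?thesis using std_normal.prob_space by (simp add: normal_law_def avg_def integral_return)
next
  case False
  with assms have s: "0 < s" by simp
  have eq: "s * normal_density x s (x + s * z) = std_normal_density z" for z
    using s by (simp add: normal_density_def real_sqrt_mult power_mult_distrib)
  have "(\<integral>y. f y \<partial>normal_law x (s\<^sup>2)) = (\<integral>y. normal_density x s y * f y \<partial>lborel)"
    using s by (simp add: normal_law_def integral_density)
  also have "\<dots> = \<bar>s\<bar> *\<^sub>R (\<integral>z. normal_density x s (x + s * z) * f (x + s * z) \<partial>lborel)"
    by (rule lborel_integral_real_affine) (use s in simp)
  also have "\<dots> = (\<integral>z. std_normal_density z * f (x + s * z) \<partial>lborel)"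
    using s by (simp flip: Bochner_Integration.integral_mult_right_zero mult.assoc add: eq)
  also have "\<dots> = avg std_normal_distribution s f x"
    by (simp add: avg_def integral_density)
  finally show ?thesis .
qed

section \<open>Attainment of the maximum in the scheme\<close>

lemma Greatest_image:
  fixes g :: "real \<Rightarrow> real"
  assumes "a \<le> b" "continuous_on {a..b} g"
  obtains v where "v \<in> {a..b}" "(GREATEST m. m \<in> g ` {a..b}) = g v" "\<And>w. w \<in> {a..b} \<Longrightarrow> g w \<le> g v"
proof -
  obtain v where v: "v \<in> {a..b}" "\<And>w. w \<in> {a..b} \<Longrightarrow> g w \<le> g v"
    using continuous_attains_sup[of "{a..b}" g] assms by auto
  then have "(GREATEST m. m \<in> g ` {a..b}) = g v"
    by (intro Greatest_equality) auto
  with v that show thesis by blast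
qed

text \<open>Later arguments use the maximum only through these two properties: some admissible
  volatility attains it, and it dominates every admissible average. For \<open>n = 0\<close>
  division by zero turns both sides into point evaluations, so no case distinction arises.\<close>

lemma phi_scheme_step:
  assumes "exp_lip C (phi_scheme \<sigma>l \<sigma>u \<phi> n i)" "0 \<le> \<sigma>l" "\<sigma>l \<le> \<sigma>u"
  obtains v where "v \<in> {\<sigma>l..\<sigma>u}"
    "phi_scheme \<sigma>l \<sigma>u \<phi> n (Suc i) x = avg std_normal_distribution (v / sqrt n) (phi_scheme \<sigma>l \<sigma>u \<phi> n i) x"
    "\<And>w. w \<in> {\<sigma>l..\<sigma>u} \<Longrightarrow>
       avg std_normal_distribution (w / sqrt n) (phi_scheme \<sigma>l \<sigma>u \<phi> n i) x \<le> phi_scheme \<sigma>l \<sigma>u \<phi> n (Suc i) x"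
proof -
  let ?f = "phi_scheme \<sigma>l \<sigma>u \<phi> n i"
  let ?g = "\<lambda>v. \<integral>y. ?f y \<partial>normal_law x (v\<^sup>2 / real n)"
  have eq: "?g v = avg std_normal_distribution (v / sqrt n) ?f x" if "v \<in> {\<sigma>l..\<sigma>u}" for v
    using integral_normal_law[of "v / sqrt n" ?f x] that assms exp_lip_measurable[OF assms(1)]
    by (simp add: power_divide)
  have "continuous_on {\<sigma>l..\<sigma>u} (\<lambda>v. avg std_normal_distribution (v / sqrt n) ?f x)"
    by (rule continuous_on_compose2[OF avg_continuous_scale[OF assms(1), of UNIV]])
       (auto simp: divide_inverse intro!: continuous_intros)
  then have "continuous_on {\<sigma>l..\<sigma>u} ?g"
    by (subst continuous_on_cong[OF refl eq])
  then obtain v where "v \<in> {\<sigma>l..\<sigma>u}" "(GREATEST m. m \<in> ?g ` {\<sigma>l..\<sigma>u}) = ?g v"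
    "\<And>w. w \<in> {\<sigma>l..\<sigma>u} \<Longrightarrow> ?g w \<le> ?g v"
    using Greatest_image[OF assms(3)] by blast
  then show thesis using eq by (intro that[of v]) auto
qed

lemma phi_scheme_exp_lip:
  assumes "exp_lip C \<phi>" "0 \<le> \<sigma>l" "\<sigma>l \<le> \<sigma>u"
  shows "\<exists>C. exp_lip C (phi_scheme \<sigma>l \<sigma>u \<phi> n i)"
proof (induction i)
  case 0
  then show ?case using assms by auto
next
  case (Suc i)
  then obtain C where C: "exp_lip C (phi_scheme \<sigma>l \<sigma>u \<phi> n i)" by blast
  define K where "K = C * (LINT z|std_normal_distribution. exp (\<sigma>u / sqrt n * \<bar>z\<bar>))"
  let ?f = "phi_scheme \<sigma>l \<sigma>u \<phi> n i"
  have avg: "exp_lip K (avg std_normal_distribution (v / sqrt n) ?f)" if "v \<in> {\<sigma>l..\<sigma>u}" for v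
    unfolding K_def using that assms by (intro avg_exp_lip C) (simp add: divide_right_mono)
  have "phi_scheme \<sigma>l \<sigma>u \<phi> n (Suc i) x - phi_scheme \<sigma>l \<sigma>u \<phi> n (Suc i) y \<le> K * (exp \<bar>x\<bar> + exp \<bar>y\<bar>) * \<bar>x - y\<bar>" for x y
  proof -
    \<comment> \<open>The maximizer at \<open>x\<close> is an admissible competitor at
      \<open>y\<close>, so the difference of the two maxima is at most the difference of two
      averages with the same \<open>v\<close>.\<close>
    obtain v where v: "v \<in> {\<sigma>l..\<sigma>u}"
      "phi_scheme \<sigma>l \<sigma>u \<phi> n (Suc i) x = avg std_normal_distribution (v / sqrt n) ?f x"
      using phi_scheme_step[OF C assms(2,3)] by metis
    moreover have "avg std_normal_distribution (v / sqrt n) ?f y \<le> phi_scheme \<sigma>l \<sigma>u \<phi> n (Suc i) y"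
      using phi_scheme_step[OF C assms(2,3)] v(1) by metis
    ultimately show ?thesis
      using exp_lipD[OF avg[OF v(1)], of x y] by linarith
  qed
  then have "exp_lip K (phi_scheme \<sigma>l \<sigma>u \<phi> n (Suc i))"
    unfolding exp_lip_def by (metis abs_le_iff abs_minus_commute add.commute minus_diff_eq)
  then show ?case ..
qed

section \<open>Comparison of viscosity subsolutions with smooth functions\<close>

lemma C12_on_add_penalty:
  assumes w: "C12_on ({a<..<b} \<times> UNIV) w wt wx wxx"
  shows "C12_on ({a<..<b} \<times> UNIV)
    (\<lambda>s y. w s y + c + \<kappa> * (b - s) + \<eta> * (y\<^sup>2 + K * (b - s) + 1 / (s - a)))
    (\<lambda>s y. wt s y - \<kappa> - \<eta> * (K + 1 / (s - a)\<^sup>2)) (\<lambda>s y. wx s y + 2 * \<eta> * y) (\<lambda>s y. wxx s y + 2 * \<eta>)"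
proof -
  let ?U = "{a<..<b} \<times> (UNIV :: real set)"
  have cont: "continuous_on ?U (\<lambda>(s, y). w s y)" "continuous_on ?U (\<lambda>(s, y). wt s y)"
    "continuous_on ?U (\<lambda>(s, y). wx s y)" "continuous_on ?U (\<lambda>(s, y). wxx s y)"
    using w by (auto simp: C12_on_def)
  have d1: "((\<lambda>s. w s y + c + \<kappa> * (b - s) + \<eta> * (y\<^sup>2 + K * (b - s) + 1 / (s - a))) has_real_derivative
      wt s y - \<kappa> - \<eta> * (K + 1 / (s - a)\<^sup>2)) (at s)"
    and d2: "((\<lambda>y. w s y + c + \<kappa> * (b - s) + \<eta> * (y\<^sup>2 + K * (b - s) + 1 / (s - a))) has_real_derivative
      wx s y + 2 * \<eta> * y) (at y)"
    and d3: "((\<lambda>y. wx s y + 2 * \<eta> * y) has_real_derivative wxx s y + 2 * \<eta>) (at y)"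
    if s: "s \<in> {a<..<b}" for s y
  proof -
    have w': "((\<lambda>s. w s y) has_real_derivative wt s y) (at s)"
      "((\<lambda>y. w s y) has_real_derivative wx s y) (at y)"
      "((\<lambda>y. wx s y) has_real_derivative wxx s y) (at y)"
      using w s by (auto simp: C12_on_def)
    have inv: "((\<lambda>s. 1 / (s - a)) has_real_derivative - (1 / (s - a)\<^sup>2)) (at s)"
      using s by (auto intro!: derivative_eq_intros simp: power2_eq_square)
    have gen: "((\<lambda>s. w s y + c + \<kappa> * (b - s) + \<eta> * (y\<^sup>2 + K * (b - s) + g s)) has_real_derivative
      wt s y - \<kappa> - \<eta> * (K + - g')) (at s)" if "(g has_real_derivative g') (at s)" for g g'
      by (auto intro!: derivative_eq_intros w'(1) that simp: algebra_simps)
    show "((\<lambda>s. w s y + c + \<kappa> * (b - s) + \<eta> * (y\<^sup>2 + K * (b - s) + 1 / (s - a))) has_real_derivative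
      wt s y - \<kappa> - \<eta> * (K + 1 / (s - a)\<^sup>2)) (at s)"
      using gen[OF inv] by simp
    show "((\<lambda>y. w s y + c + \<kappa> * (b - s) + \<eta> * (y\<^sup>2 + K * (b - s) + 1 / (s - a))) has_real_derivative
      wx s y + 2 * \<eta> * y) (at y)"
      by (auto intro!: derivative_eq_intros w'(2) simp: algebra_simps)
    show "((\<lambda>y. wx s y + 2 * \<eta> * y) has_real_derivative wxx s y + 2 * \<eta>) (at y)"
      by (auto intro!: derivative_eq_intros w'(3))
  qed
  show ?thesis
    unfolding C12_on_def
    using d1 d2 d3 cont
    by (auto simp: case_prod_unfold intro!: continuous_intros)
qed

text \<open>Suppose the inequality fails at (t0, x0). A small penalty added to w + c + \<kappa> (b -
  t) leaves the excess of u positive there and makes it attain its maximum in the open strip. The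
  penalized function is then itself a test function at the maximum, and the subsolution inequality
  contradicts \<open>eqn\<close>. The residual \<kappa> of w is compensated by the slope of \<kappa>
  (b - t).\<close>

lemma viscosity_subsolution_le_supersolution_interior:
  assumes ab: "0 \<le> a" "a < b" "b \<le> 1"
    and G_mono: "\<And>p q. p \<le> q \<Longrightarrow> G p \<le> G q"
    and G_lip: "\<And>p q. 0 \<le> q \<Longrightarrow> G (p + q) \<le> G p + \<Lambda> * q"
    and u: "continuous_on ({a..b} \<times> UNIV) (\<lambda>(t, x). u t x)" "viscosity_subsolution G u"
    and w: "continuous_on ({a..b} \<times> UNIV) (\<lambda>(t, x). w t x)" "C12_on ({a<..<b} \<times> UNIV) w wt wx wxx"
    and eqn: "\<And>t x. a < t \<Longrightarrow> t < b \<Longrightarrow> wt t x + G (wxx t x) \<le> \<kappa>"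
    and bdd: "\<And>t x. a \<le> t \<Longrightarrow> t \<le> b \<Longrightarrow> u t x - w t x \<le> B"
    and final_le: "\<And>x. u b x \<le> w b x + c"
    and t0: "a < t0" "t0 \<le> b"
  shows "u t0 x0 \<le> w t0 x0 + c + \<kappa> * (b - t0)"
proof (rule ccontr)
  assume neg: "\<not> ?thesis"
  define d where "d = u t0 x0 - (w t0 x0 + c + \<kappa> * (b - t0))"
  have d: "0 < d" using neg by (simp add: d_def)
  have \<Lambda>: "0 \<le> \<Lambda>" using G_lip[of 1 0] G_mono[of 0 1] by simp
  define K where "K = 2 * \<Lambda> + 1"
  define p where "p = x0\<^sup>2 + K * (b - t0) + 1 / (t0 - a)"
  have p: "0 < p" unfolding p_def K_def using t0 \<Lambda> by (intro add_nonneg_pos add_nonneg_nonneg) auto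
  \<comment> \<open>\<open>p\<close> is the penalty at (t0, x0), so this weight uses up exactly half
    of the excess \<open>d\<close>.\<close>
  define \<eta> where "\<eta> = d / (2 * p)"
  have \<eta>: "0 < \<eta>" using d p by (simp add: \<eta>_def)
  \<comment> \<open>The term in \<open>y\<^sup>2\<close> makes a maximum of \<open>u - \<psi>\<close> exist, the one in \<open>1 / (s - a)\<close> keeps it
    away from the initial time, and \<open>K\<close> outweighs the second derivative \<open>2 * \<eta>\<close> of the former.\<close>
  define \<psi> where "\<psi> = (\<lambda>s y. w s y + c + \<kappa> * (b - s) + \<eta> * (y\<^sup>2 + K * (b - s) + 1 / (s - a)))"
  define \<Phi> where "\<Phi> = (\<lambda>z. u (fst z) (snd z) - \<psi> (fst z) (snd z))"
  have pos: "0 < \<Phi> (t0, x0)"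
  proof -
    have "\<Phi> (t0, x0) = d - \<eta> * p" by (simp add: \<Phi>_def \<psi>_def d_def p_def)
    also have "\<dots> = d / 2" using p by (simp add: \<eta>_def)
    finally show ?thesis using d by simp
  qed
  define B1 where "B1 = \<bar>B\<bar> + \<bar>c\<bar> + \<bar>\<kappa>\<bar> * (b - a) + 1"
  have B1: "0 < B1" using ab by (simp add: B1_def add_nonneg_pos)
  have le: "\<Phi> (s, y) \<le> B1 - \<eta> * (y\<^sup>2 + 1 / (s - a))" if s: "a < s" "s \<le> b" for s y
  proof -
    have "\<bar>\<kappa> * (b - s)\<bar> \<le> \<bar>\<kappa>\<bar> * (b - a)" using s ab by (simp add: abs_mult mult_left_mono)
    moreover have "0 \<le> \<eta> * (K * (b - s))" using s \<eta> \<Lambda> by (simp add: K_def)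
    ultimately show ?thesis
      using bdd[of s y] s unfolding \<Phi>_def \<psi>_def B1_def fst_conv snd_conv distrib_left by linarith
  qed
  \<comment> \<open>By \<open>le\<close>, the excess is nonpositive as soon as \<eta> / (s - a) or
    \<eta> y^2 reaches \<open>B1\<close>; this dictates the sides of the rectangle. The summand 1 in
    the range of y ensures y^2 \<ge> |y|, which avoids a square root.\<close>
  define C where "C = {a + \<eta> / B1..b} \<times> {-(1 + B1 / \<eta>)..1 + B1 / \<eta>}"
  have outside: "\<Phi> (s, y) \<le> 0" if s: "a < s" "s \<le> b" and out: "(s, y) \<notin> C" for s y
  proof (rule order_trans[OF le[OF s]])
    consider "s < a + \<eta> / B1" | "1 + B1 / \<eta> < \<bar>y\<bar>" using out s by (fastforce simp: C_def)
    then have "B1 \<le> \<eta> * (y\<^sup>2 + 1 / (s - a))"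
    proof cases
      case 1
      then have "B1 * (s - a) < \<eta>" using B1 by (simp add: field_simps)
      then have "B1 \<le> \<eta> * (1 / (s - a))" using s by (simp add: field_simps)
      then show ?thesis using \<eta> by (simp add: distrib_left add_increasing)
    next
      case 2
      have "1 \<le> 1 + B1 / \<eta>" using B1 \<eta> by simp
      then have "1 * \<bar>y\<bar> \<le> \<bar>y\<bar> * \<bar>y\<bar>" using 2 by (intro mult_right_mono) linarith+
      then have "B1 / \<eta> \<le> y\<^sup>2" using 2 by (simp add: power2_eq_square flip: abs_mult)
      then have "B1 \<le> \<eta> * y\<^sup>2" using \<eta> by (simp add: field_simps)
      then show ?thesis using \<eta> s by (simp add: distrib_left add_increasing2)
    qed
    then show "B1 - \<eta> * (y\<^sup>2 + 1 / (s - a)) \<le> 0" by simp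
  qed
  have in_C: "(t0, x0) \<in> C" using outside[OF t0] pos by fastforce
  have sub: "C \<subseteq> {a<..b} \<times> UNIV"
    using divide_pos_pos[OF \<eta> B1] by (auto simp: C_def)
  have "continuous_on C \<Phi>"
    unfolding \<Phi>_def \<psi>_def
    using u(1) w(1) sub
    by (auto simp: case_prod_unfold intro!: continuous_intros elim!: continuous_on_subset)
  moreover have "compact C" unfolding C_def by (intro compact_Times) auto
  ultimately obtain z1 where "z1 \<in> C" "\<And>z. z \<in> C \<Longrightarrow> \<Phi> z \<le> \<Phi> z1"
    using continuous_attains_sup[of C \<Phi>] in_C by blast
  then obtain s1 y1 where max: "(s1, y1) \<in> C" "\<And>z. z \<in> C \<Longrightarrow> \<Phi> z \<le> \<Phi> (s1, y1)"
    by (cases z1) blast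
  have \<Phi>1: "0 < \<Phi> (s1, y1)" using max(2)[OF in_C] pos by simp
  have s1: "a < s1" "s1 \<le> b" using max(1) sub by auto
  have "s1 \<noteq> b"
  proof
    assume "s1 = b"
    moreover have "0 \<le> \<eta> * (y1\<^sup>2 + 1 / (b - a))" using \<eta> ab by simp
    ultimately show False using \<Phi>1 final_le[of y1] by (simp add: \<Phi>_def \<psi>_def)
  qed
  then have s1': "s1 < b" using s1 by simp
  let ?U = "{a<..<b} \<times> (UNIV :: real set)"
  \<comment> \<open>Off \<open>C\<close> the excess is nonpositive while at (s1, y1) it is positive,
    so the maximum over the compact set is one over the whole strip.\<close>
  have glob: "u s y - \<psi> s y \<le> u s1 y1 - \<psi> s1 y1" if "(s, y) \<in> ?U" for s y
    using that max(2)[of "(s, y)"] outside[of s y] \<Phi>1 by (cases "(s, y) \<in> C") (auto simp: \<Phi>_def)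
  have C12: "C12_on ?U \<psi> (\<lambda>s y. wt s y - \<kappa> - \<eta> * (K + 1 / (s - a)\<^sup>2))
      (\<lambda>s y. wx s y + 2 * \<eta> * y) (\<lambda>s y. wxx s y + 2 * \<eta>)"
    unfolding \<psi>_def by (rule C12_on_add_penalty[OF w(2)])
  have U: "open ?U" "?U \<subseteq> {0<..<1} \<times> UNIV" using ab by (auto intro: open_Times)
  have "0 \<le> \<psi>t s1 y1 + G (\<psi>xx s1 y1)" if "C12_on ?U \<psi> \<psi>t \<psi>x \<psi>xx" for \<psi>t \<psi>x \<psi>xx
    using u(2)[unfolded viscosity_subsolution_def, rule_format, of ?U s1 y1 \<psi> \<psi>t \<psi>x \<psi>xx] that U glob s1 s1'
    by fastforce
  from this[OF C12] have "0 \<le> wt s1 y1 - \<kappa> - \<eta> * (K + 1 / (s1 - a)\<^sup>2) + G (wxx s1 y1 + 2 * \<eta>)" .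
  also have "G (wxx s1 y1 + 2 * \<eta>) \<le> G (wxx s1 y1) + \<Lambda> * (2 * \<eta>)"
    using \<eta> by (intro G_lip) simp
  also have "wt s1 y1 - \<kappa> - \<eta> * (K + 1 / (s1 - a)\<^sup>2) + (G (wxx s1 y1) + \<Lambda> * (2 * \<eta>)) \<le>
      \<Lambda> * (2 * \<eta>) - \<eta> * (K + 1 / (s1 - a)\<^sup>2)"
    using eqn[OF s1(1) s1', of y1] by simp
  \<comment> \<open>The choice K = 2 * \<Lambda> + 1 cancels the cost 2 * \<Lambda> * \<eta> of the
    quadratic penalty and leaves -\<eta>; the term from 1 / (s - a) only helps.\<close>
  also have "\<dots> \<le> - \<eta>" using \<eta> by (simp add: K_def algebra_simps)
  finally show False using \<eta> by simp
qed

text \<open>The penalty blows up at time \<open>a\<close>, so the inequality is first known for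
  later times and reaches \<open>a\<close> by continuity in t.\<close>

lemma viscosity_subsolution_le_supersolution:
  assumes ab: "0 \<le> a" "a < b" "b \<le> 1"
    and G_mono: "\<And>p q. p \<le> q \<Longrightarrow> G p \<le> G q"
    and G_lip: "\<And>p q. 0 \<le> q \<Longrightarrow> G (p + q) \<le> G p + \<Lambda> * q"
    and u: "continuous_on ({a..b} \<times> UNIV) (\<lambda>(t, x). u t x)" "viscosity_subsolution G u"
    and w: "continuous_on ({a..b} \<times> UNIV) (\<lambda>(t, x). w t x)" "C12_on ({a<..<b} \<times> UNIV) w wt wx wxx"
    and eqn: "\<And>t x. a < t \<Longrightarrow> t < b \<Longrightarrow> wt t x + G (wxx t x) \<le> \<kappa>"
    and bdd: "\<And>t x. a \<le> t \<Longrightarrow> t \<le> b \<Longrightarrow> u t x - w t x \<le> B"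
    and final_le: "\<And>x. u b x \<le> w b x + c"
  shows "u a x \<le> w a x + c + \<kappa> * (b - a)"
proof -
  let ?g = "\<lambda>t. w t x + c + \<kappa> * (b - t) - u t x"
  have c: "continuous_on {a..b} (\<lambda>t. v t x)" if "continuous_on ({a..b} \<times> UNIV) (\<lambda>(t, x). v t x)"
    for v :: "real \<Rightarrow> real \<Rightarrow> real"
  proof -
    have "continuous_on {a..b} (\<lambda>t. (t, x))" by (intro continuous_intros)
    from continuous_on_compose2[OF that this] show ?thesis by auto
  qed
  have cl: "closure {a<..b} = {a..b}" using ab by simp
  have "continuous_on (closure {a<..b}) ?g"
    unfolding cl by (intro continuous_intros c u w)
  moreover have "a \<in> closure {a<..b}" unfolding cl using ab by simp
  moreover have "0 \<le> ?g t" if "t \<in> {a<..b}" for t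
    using viscosity_subsolution_le_supersolution_interior[OF assms, of t x] that by simp
  ultimately have "0 \<le> ?g a"
    by (rule continuous_ge_on_closure[where f="?g"])
  then show ?thesis by simp
qed

section \<open>Averages of bounded Lipschitz functions\<close>

definition bdd_lip :: "real \<Rightarrow> real \<Rightarrow> (real \<Rightarrow> real) \<Rightarrow> bool" where
  "bdd_lip B L f \<longleftrightarrow> (\<forall>x. \<bar>f x\<bar> \<le> B) \<and> (\<forall>x y. \<bar>f x - f y\<bar> \<le> L * \<bar>x - y\<bar>)"

lemma bdd_lipD:
  assumes "bdd_lip B L f"
  shows "\<bar>f x\<bar> \<le> B" "\<bar>f x - f y\<bar> \<le> L * \<bar>x - y\<bar>"
  using assms by (auto simp: bdd_lip_def)

lemma bdd_lip_nonneg: "bdd_lip B L f \<Longrightarrow> 0 \<le> L"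
  using bdd_lipD(2)[of B L f 1 0] by simp

lemma bdd_lip_exp_lip: "bdd_lip B L f \<Longrightarrow> exp_lip L f"
  using bdd_lip_nonneg bdd_lipD(2) lipschitz_imp_exp_lip by blast

lemma bdd_lip_measurable: "bdd_lip B L f \<Longrightarrow> f \<in> borel_measurable borel"
  by (blast intro: exp_lip_measurable bdd_lip_exp_lip)

lemma bdd_lip_isCont: "bdd_lip B L f \<Longrightarrow> isCont f x"
  using exp_lip_continuous[OF bdd_lip_exp_lip] by (simp add: continuous_on_eq_continuous_at)

context real_distribution
begin

lemma avg_integrable:
  assumes "bdd_lip B L f" shows "integrable M (\<lambda>z. f (x + s * z))"
proof -
  have [measurable]: "f \<in> borel_measurable borel" by (rule bdd_lip_measurable[OF assms])
  show ?thesis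
    by (rule integrable_const_bound[where B=B]) (auto intro!: AE_I2 bdd_lipD[OF assms])
qed

lemma avg_le_avg_add:
  assumes f: "bdd_lip B L f" and g: "bdd_lip B' L' g" and "\<And>x. f x \<le> g x + e"
  shows "avg M s f x \<le> avg M s g x + e"
proof -
  have "avg M s f x \<le> (LINT z|M. g (x + s * z) + e)"
    unfolding avg_def
    by (intro integral_mono Bochner_Integration.integrable_add avg_integrable[OF f] avg_integrable[OF g] assms) simp
  also have "\<dots> = avg M s g x + e"
    unfolding avg_def
    using prob_space by (subst Bochner_Integration.integral_add) (auto intro!: avg_integrable[OF g])
  finally show ?thesis .
qed

text \<open>An average of translates keeps both constants exactly, so they do not deteriorate over
  arbitrarily many steps.\<close>

lemma avg_bdd_lip:
  assumes f: "bdd_lip B L f"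
  shows "bdd_lip B L (avg M s f)"
proof -
  have 1: "avg M s f x \<le> B" "- B \<le> avg M s f x" for x
    unfolding avg_def using bdd_lipD(1)[OF f]
    by (auto intro!: integral_le_const integral_ge_const avg_integrable[OF f] simp: abs_le_iff minus_le_iff)
  have 2: "avg M s f x \<le> avg M s f y + L * \<bar>x - y\<bar>" for x y
  proof -
    \<comment> \<open>Translating \<open>f\<close> by x - y turns a comparison at two points into a
      comparison of two functions at the same point.\<close>
    have g: "bdd_lip B L (\<lambda>z. f (z + (x - y)))"
      using f unfolding bdd_lip_def by (metis add_diff_cancel_right)
    have "avg M s (\<lambda>z. f (z + (x - y))) y \<le> avg M s f y + L * \<bar>x - y\<bar>"
    proof (rule avg_le_avg_add[OF g f])
      fix z show "f (z + (x - y)) \<le> f z + L * \<bar>x - y\<bar>"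
        using bdd_lipD(2)[OF f, of "z + (x - y)" z] by simp
    qed
    then show ?thesis by (simp add: avg_def algebra_simps)
  qed
  have "\<bar>avg M s f x - avg M s f y\<bar> \<le> L * \<bar>x - y\<bar>" for x y
    using 2[of x y] 2[of y x] by (simp add: abs_le_iff abs_minus_commute)
  with 1 show ?thesis by (auto simp: bdd_lip_def abs_le_iff minus_le_iff)
qed

lemma avg_mono:
  assumes "bdd_lip B L f" "bdd_lip B' L' g" "\<And>x. f x \<le> g x"
  shows "avg M s f x \<le> avg M s g x"
  using avg_le_avg_add[OF assms(1,2), of 0] assms(3) by simp

lemma avg_near:
  assumes f: "bdd_lip B L f" and z: "integrable M (\<lambda>z. \<bar>z\<bar>)" "(LINT z|M. \<bar>z\<bar>) \<le> 1"
  shows "\<bar>avg M s f x - f x\<bar> \<le> L * \<bar>s\<bar>"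
proof -
  have eq: "avg M s f x - f x = (LINT z|M. f (x + s * z) - f x)"
    unfolding avg_def
    using prob_space by (subst Bochner_Integration.integral_diff) (auto intro!: avg_integrable[OF f])
  have "\<bar>avg M s f x - f x\<bar> \<le> (LINT z|M. (L * \<bar>s\<bar>) * \<bar>z\<bar>)"
    unfolding eq
  proof (rule integral_abs_bound_integral)
    fix z show "\<bar>f (x + s * z) - f x\<bar> \<le> (L * \<bar>s\<bar>) * \<bar>z\<bar>"
      using bdd_lipD(2)[OF f, of "x + s * z" x] by (simp add: abs_mult mult.assoc)
  qed (auto intro!: Bochner_Integration.integrable_diff avg_integrable[OF f] integrable_mult_right z)
  moreover have "(LINT z|M. (L * \<bar>s\<bar>) * \<bar>z\<bar>) = L * \<bar>s\<bar> * (LINT z|M. \<bar>z\<bar>)"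
    by (rule integral_mult_right_zero)
  moreover have "L * \<bar>s\<bar> * (LINT z|M. \<bar>z\<bar>) \<le> L * \<bar>s\<bar> * 1"
    using bdd_lip_nonneg[OF f] z(2) by (intro mult_left_mono) auto
  ultimately show ?thesis by linarith
qed

end

text \<open>Fubini for a bounded integrand. This lets the inequality between successive iterates
  pass through the mollifier.\<close>

lemma avg_commute:
  assumes M: "real_distribution M" and N: "real_distribution N" and f: "bdd_lip B L f"
  shows "avg M s (avg N r f) x = avg N r (avg M s f) x"
proof -
  interpret M: real_distribution M by (rule M)
  interpret N: real_distribution N by (rule N)
  interpret pair_prob_space M N ..
  have [measurable]: "f \<in> borel_measurable borel" by (rule bdd_lip_measurable[OF f])
  have "integrable (M \<Otimes>\<^sub>M N) (\<lambda>(y, z). f (x + s * y + r * z))"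
    by (rule integrable_const_bound[where B=B]) (auto intro!: AE_I2 bdd_lipD[OF f] split: prod.splits)
  from Fubini_integral[OF this] show ?thesis
    by (simp add: avg_def algebra_simps)
qed

section \<open>Mollification by uniform averages\<close>

abbreviation unif :: "real measure" where
  "unif \<equiv> uniform_measure lborel {-1..1}"

interpretation unif: real_distribution unif
  by (intro real_distribution.intro real_distribution_axioms.intro prob_space_uniform_measure) auto

lemma unif_abs: "integrable unif (\<lambda>z. \<bar>z\<bar>)" "(LINT z|unif. \<bar>z\<bar>) \<le> 1"
proof -
  have le: "AE z in unif. \<bar>z\<bar> \<le> 1" by (rule AE_uniform_measureI) auto
  show *: "integrable unif (\<lambda>z. \<bar>z\<bar>)"
    by (rule unif.integrable_const_bound[where B=1]) (use le in auto)
  show "(LINT z|unif. \<bar>z\<bar>) \<le> 1" by (rule unif.integral_le_const[OF * le])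
qed

lemma std_normal_abs: "integrable std_normal_distribution (\<lambda>z. \<bar>z\<bar>)" "(LINT z|std_normal_distribution. \<bar>z\<bar>) \<le> 1"
proof -
  show "integrable std_normal_distribution (\<lambda>z. \<bar>z\<bar>)"
    using integrable_std_normal_distribution_moment[of 1] by simp
  have "sqrt (2 / pi) \<le> 1" using pi_gt3 by simp
  then show "(LINT z|std_normal_distribution. \<bar>z\<bar>) \<le> 1"
    using std_normal_distribution_odd_moments_abs[of 0] by simp
qed

lemma unif_eq_density: "unif = density lborel (\<lambda>x. ennreal (indicator {-1..1} x / 2))"
  unfolding uniform_measure_def
  by (intro density_cong) (auto simp: indicator_def divide_ennreal[of 1 2, simplified])

text \<open>With a primitive F of f, the uniform average over the interval of radius \<epsilon> is
  (F (x + \<epsilon>) - F (x - \<epsilon>)) / (2 * \<epsilon>).\<close>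

lemma avg_unif_DERIV:
  assumes f: "bdd_lip B L f" and \<epsilon>: "0 < \<epsilon>"
  shows "(avg unif \<epsilon> f has_real_derivative (f (x + \<epsilon>) - f (x - \<epsilon>)) / (2 * \<epsilon>)) (at x)"
proof -
  have "\<exists>F. \<forall>x::real. -\<infinity> < ereal x \<longrightarrow> ereal x < \<infinity> \<longrightarrow> (F has_vector_derivative f x) (at x)"
    by (rule einterval_antiderivative) (auto intro: bdd_lip_isCont[OF f])
  then obtain F where F: "\<And>x. (F has_real_derivative f x) (at x)"
    by (auto simp: has_real_derivative_iff_has_vector_derivative)
  have [measurable]: "f \<in> borel_measurable borel" by (rule bdd_lip_measurable[OF f])
  have "avg unif \<epsilon> f y = (F (y + \<epsilon>) - F (y - \<epsilon>)) / (2 * \<epsilon>)" for y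
  proof -
    have "avg unif \<epsilon> f y = (\<integral>z. f (y + \<epsilon> * z) * indicator {-1..1} z \<partial>lborel) / 2"
      unfolding avg_def unif_eq_density
      by (subst integral_density) (auto simp flip: integral_divide_zero intro!: Bochner_Integration.integral_cong)
    also have "(\<integral>z. f (y + \<epsilon> * z) * indicator {-1..1} z \<partial>lborel) = F (y + \<epsilon> * 1) / \<epsilon> - F (y + \<epsilon> * (-1)) / \<epsilon>"
    proof (rule integral_FTC_Icc_real)
      fix z :: real
      show "((\<lambda>z. F (y + \<epsilon> * z) / \<epsilon>) has_real_derivative f (y + \<epsilon> * z)) (at z)"
        using \<epsilon> by (auto intro!: derivative_eq_intros DERIV_chain'[where g=F, OF _ F])
      show "isCont (\<lambda>z. f (y + \<epsilon> * z)) z"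
        by (rule isCont_o2[where f="\<lambda>z. y + \<epsilon> * z" and g=f]) (auto intro: bdd_lip_isCont[OF f])
    qed simp
    finally show ?thesis by (simp add: diff_divide_distrib)
  qed
  then have "avg unif \<epsilon> f = (\<lambda>y. (F (y + \<epsilon>) - F (y - \<epsilon>)) / (2 * \<epsilon>))" by auto
  moreover have "((\<lambda>y. (F (y + \<epsilon>) - F (y - \<epsilon>)) / (2 * \<epsilon>)) has_real_derivative
      (f (x + \<epsilon>) * 1 - f (x - \<epsilon>) * 1) / (2 * \<epsilon>)) (at x)"
    by (intro DERIV_cdivide DERIV_diff DERIV_chain'[where g=F, OF _ F, THEN DERIV_cong]) (auto intro!: derivative_eq_intros)
  ultimately show ?thesis by simp
qed

text \<open>
  Averaging twice over an interval makes a Lipschitz function twice differentiable with derivatives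
  that are plain difference quotients; being an average, it commutes with Gaussian averages.
\<close>

definition mollify :: "real \<Rightarrow> (real \<Rightarrow> real) \<Rightarrow> real \<Rightarrow> real" where
  "mollify \<epsilon> f = avg unif \<epsilon> (avg unif \<epsilon> f)"

definition mollify_D1 :: "real \<Rightarrow> (real \<Rightarrow> real) \<Rightarrow> real \<Rightarrow> real" where
  "mollify_D1 \<epsilon> f x = (avg unif \<epsilon> f (x + \<epsilon>) - avg unif \<epsilon> f (x - \<epsilon>)) / (2 * \<epsilon>)"

definition mollify_D2 :: "real \<Rightarrow> (real \<Rightarrow> real) \<Rightarrow> real \<Rightarrow> real" where
  "mollify_D2 \<epsilon> f x = (f (x + 2 * \<epsilon>) - 2 * f x + f (x - 2 * \<epsilon>)) / (4 * \<epsilon>\<^sup>2)"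

lemma mollify_DERIV:
  assumes f: "bdd_lip B L f" and \<epsilon>: "0 < \<epsilon>"
  shows "(mollify \<epsilon> f has_real_derivative mollify_D1 \<epsilon> f x) (at x)"
    and "(mollify_D1 \<epsilon> f has_real_derivative mollify_D2 \<epsilon> f x) (at x)"
proof -
  show "(mollify \<epsilon> f has_real_derivative mollify_D1 \<epsilon> f x) (at x)"
    unfolding mollify_def mollify_D1_def by (intro avg_unif_DERIV[OF unif.avg_bdd_lip[OF f] \<epsilon>])
  have "mollify_D1 \<epsilon> f = (\<lambda>x. (avg unif \<epsilon> f (x + \<epsilon>) - avg unif \<epsilon> f (x - \<epsilon>)) / (2 * \<epsilon>))"
    by (auto simp: mollify_D1_def)
  then show "(mollify_D1 \<epsilon> f has_real_derivative mollify_D2 \<epsilon> f x) (at x)"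
    using \<epsilon> by (auto intro!: derivative_eq_intros DERIV_chain'[OF _ avg_unif_DERIV[OF f \<epsilon>]]
      simp: mollify_D2_def power2_eq_square field_simps)
qed

text \<open>The coefficients 1, -2, 1 of the second difference have total absolute value 4, which
  cancels the 4 in the denominator. \<open>mollify_D2_dist\<close> rests on the same count.\<close>

lemma mollify_D2_lipschitz:
  assumes f: "bdd_lip B L f" and \<epsilon>: "0 < \<epsilon>"
  shows "\<bar>mollify_D2 \<epsilon> f x - mollify_D2 \<epsilon> f y\<bar> \<le> L / \<epsilon>\<^sup>2 * \<bar>x - y\<bar>"
proof -
  let ?n = "\<lambda>x. f (x + 2 * \<epsilon>) - 2 * f x + f (x - 2 * \<epsilon>)"
  have "\<bar>?n x - ?n y\<bar> \<le> 4 * (L * \<bar>x - y\<bar>)"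
    using bdd_lipD(2)[OF f, of "x + 2 * \<epsilon>" "y + 2 * \<epsilon>"] bdd_lipD(2)[OF f, of x y]
      bdd_lipD(2)[OF f, of "x - 2 * \<epsilon>" "y - 2 * \<epsilon>"] by (simp add: abs_le_iff)
  then have "\<bar>?n x - ?n y\<bar> / (4 * \<epsilon>\<^sup>2) \<le> 4 * (L * \<bar>x - y\<bar>) / (4 * \<epsilon>\<^sup>2)"
    by (rule divide_right_mono) simp
  moreover have "mollify_D2 \<epsilon> f x - mollify_D2 \<epsilon> f y = (?n x - ?n y) / (4 * \<epsilon>\<^sup>2)"
    by (simp add: mollify_D2_def diff_divide_distrib)
  ultimately show ?thesis by (simp add: abs_divide)
qed

lemma mollify_D2_dist:
  assumes fg: "\<And>x. \<bar>f x - g x\<bar> \<le> e" and \<epsilon>: "0 < \<epsilon>"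
  shows "\<bar>mollify_D2 \<epsilon> f x - mollify_D2 \<epsilon> g x\<bar> \<le> e / \<epsilon>\<^sup>2"
proof -
  let ?n = "\<lambda>f. f (x + 2 * \<epsilon>) - 2 * f x + f (x - 2 * \<epsilon>)"
  have "\<bar>?n f - ?n g\<bar> \<le> 4 * e"
    using fg[of "x + 2 * \<epsilon>"] fg[of x] fg[of "x - 2 * \<epsilon>"] by (simp add: abs_le_iff)
  then have "\<bar>?n f - ?n g\<bar> / (4 * \<epsilon>\<^sup>2) \<le> 4 * e / (4 * \<epsilon>\<^sup>2)"
    by (rule divide_right_mono) simp
  moreover have "mollify_D2 \<epsilon> f x - mollify_D2 \<epsilon> g x = (?n f - ?n g) / (4 * \<epsilon>\<^sup>2)"
    by (simp add: mollify_D2_def diff_divide_distrib)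
  ultimately show ?thesis by (simp add: abs_divide)
qed

lemma mollify_bdd_lip: "bdd_lip B L f \<Longrightarrow> bdd_lip B L (mollify \<epsilon> f)"
  unfolding mollify_def by (intro unif.avg_bdd_lip)

lemma mollify_near:
  assumes f: "bdd_lip B L f" and \<epsilon>: "0 < \<epsilon>"
  shows "\<bar>mollify \<epsilon> f x - f x\<bar> \<le> 2 * L * \<epsilon>"
  using unif.avg_near[OF unif.avg_bdd_lip[OF f] unif_abs, of \<epsilon> \<epsilon> x] unif.avg_near[OF f unif_abs, of \<epsilon> x] \<epsilon>
  unfolding mollify_def by linarith

lemma mollify_mono:
  assumes f: "bdd_lip B L f" and g: "bdd_lip B' L' g" and "\<And>x. f x \<le> g x"
  shows "mollify \<epsilon> f x \<le> mollify \<epsilon> g x"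
  unfolding mollify_def by (intro unif.avg_mono[OF unif.avg_bdd_lip[OF f] unif.avg_bdd_lip[OF g]] unif.avg_mono[OF f g] assms)

lemma mollify_avg:
  assumes M: "real_distribution M" and f: "bdd_lip B L f"
  shows "mollify \<epsilon> (avg M s f) = avg M s (mollify \<epsilon> f)"
proof -
  have "avg unif \<epsilon> (avg M s f) = avg M s (avg unif \<epsilon> f)"
    by (intro ext avg_commute[OF unif.real_distribution_axioms M f])
  moreover have "avg unif \<epsilon> (avg M s (avg unif \<epsilon> f)) = avg M s (avg unif \<epsilon> (avg unif \<epsilon> f))"
    by (intro ext avg_commute[OF unif.real_distribution_axioms M unif.avg_bdd_lip[OF f]])
  ultimately show ?thesis by (simp add: mollify_def)
qed

text \<open>Lagrange form of the remainder: the second derivative is taken at a point within |h| of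
  x, and moving it to x costs K |h|. The cruder constant K / 2 in place of K / 6 is enough.\<close>

lemma taylor2_lower:
  fixes m :: "real \<Rightarrow> real"
  assumes d: "\<And>x. (m has_real_derivative m' x) (at x)" "\<And>x. (m' has_real_derivative m'' x) (at x)"
    and lip: "\<And>x y. \<bar>m'' x - m'' y\<bar> \<le> K * \<bar>x - y\<bar>"
  shows "m x + m' x * h + m'' x / 2 * h\<^sup>2 - K / 2 * \<bar>h\<bar> ^ 3 \<le> m (x + h)"
proof (cases "h = 0")
  case False
  have K: "0 \<le> K" using lip[of 1 0] by simp
  define diff where "diff = (\<lambda>i::nat. if i = 0 then m else if i = 1 then m' else m'')"
  have "\<exists>t. (if x + h < x then x + h < t \<and> t < x else x < t \<and> t < x + h) \<and>
      m (x + h) = (\<Sum>i<2. diff i x / fact i * (x + h - x) ^ i) + diff 2 t / fact 2 * (x + h - x) ^ 2"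
    by (rule Taylor[of 2 diff m "min x (x + h)" "max x (x + h)"])
       (use False d in \<open>auto simp: diff_def less_2_cases_iff\<close>)
  then obtain t where t: "if x + h < x then x + h < t \<and> t < x else x < t \<and> t < x + h"
    and "m (x + h) = (\<Sum>i<2. diff i x / fact i * (x + h - x) ^ i) + diff 2 t / fact 2 * (x + h - x) ^ 2"
    by blast
  then have eq: "m (x + h) = m x + m' x * h + m'' t / 2 * h\<^sup>2"
    by (simp add: diff_def numeral_2_eq_2)
  have t: "\<bar>t - x\<bar> \<le> \<bar>h\<bar>" using t by (auto split: if_splits)
  have "\<bar>m'' t - m'' x\<bar> \<le> K * \<bar>h\<bar>"
    using lip[of t x] mult_left_mono[OF t K] by linarith
  then have "(m'' x - K * \<bar>h\<bar>) / 2 * h\<^sup>2 \<le> m'' t / 2 * h\<^sup>2"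
    by (intro mult_right_mono divide_right_mono) auto
  then show ?thesis using eq by (simp add: power3_eq_cube power2_eq_square algebra_simps)
qed simp

text \<open>The Taylor bound is integrated against the standard normal law: the linear term
  vanishes, the second moment is 1, and the third absolute moment 2 * sqrt (2 / pi) is at most 2,
  which turns K / 2 into K.\<close>

lemma avg_taylor2_lower:
  assumes f: "bdd_lip B L m"
    and d: "\<And>x. (m has_real_derivative m' x) (at x)" "\<And>x. (m' has_real_derivative m'' x) (at x)"
    and lip: "\<And>x y. \<bar>m'' x - m'' y\<bar> \<le> K * \<bar>x - y\<bar>"
    and s: "0 \<le> s"
  shows "m x + m'' x / 2 * s\<^sup>2 - K * s ^ 3 \<le> avg std_normal_distribution s m x"
proof -
  let ?N = std_normal_distribution
  have K: "0 \<le> K" using lip[of 1 0] by simp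
  have i: "integrable ?N (\<lambda>z. z)" "integrable ?N (\<lambda>z. z\<^sup>2)" "integrable ?N (\<lambda>z. \<bar>z\<bar> ^ 3)"
    using integrable_std_normal_distribution_moment[of 1] integrable_std_normal_distribution_moment[of 2]
      integrable_abs[OF integrable_std_normal_distribution_moment[of 3]] by (auto simp: power_abs)
  have e: "(LINT z|?N. z) = 0" "(LINT z|?N. z\<^sup>2) = 1"
    using integral_std_normal_distribution_moment_odd[of 1] std_normal_distribution_even_moments(1)[of 1] by auto
  have e3: "(LINT z|?N. \<bar>z\<bar> ^ 3) \<le> 2"
  proof -
    have "sqrt (2 / pi) \<le> 1" using pi_gt3 by simp
    then show ?thesis using std_normal_distribution_odd_moments_abs[of 1] by (simp add: numeral_3_eq_3)
  qed
  let ?g = "\<lambda>z. m x + m' x * s * z + m'' x / 2 * s\<^sup>2 * z\<^sup>2 - K / 2 * s ^ 3 * \<bar>z\<bar> ^ 3"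
  have "(LINT z|?N. ?g z) = m x + m' x * s * 0 + m'' x / 2 * s\<^sup>2 * 1 - K / 2 * s ^ 3 * (LINT z|?N. \<bar>z\<bar> ^ 3)"
    using i std_normal.prob_space by (simp add: e)
  moreover have "K / 2 * s ^ 3 * (LINT z|?N. \<bar>z\<bar> ^ 3) \<le> K / 2 * s ^ 3 * 2"
    using K s e3 by (intro mult_left_mono) auto
  moreover have "(LINT z|?N. ?g z) \<le> avg ?N s m x"
    unfolding avg_def
  proof (rule integral_mono)
    show "integrable ?N ?g" using i by (intro Bochner_Integration.integrable_add Bochner_Integration.integrable_diff integrable_mult_right) auto
    fix z show "?g z \<le> m (x + s * z)"
      using taylor2_lower[OF d lip, of x "s * z"] s by (simp add: abs_mult power_mult_distrib mult.assoc)
  qed (rule std_normal.avg_integrable[OF f])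
  ultimately show ?thesis by linarith
qed

section \<open>Viscosity subsolutions and discrete supersolutions\<close>

text \<open>Together with \<open>G_fun_upper\<close> this represents G as the maximum of \<sigma>^2
  / 2 * p over the volatility interval, attained at an endpoint chosen by the sign of p.\<close>

lemma G_fun_attained:
  obtains \<sigma> where "\<sigma> \<in> {\<sigma>l, \<sigma>u}" "G_fun \<sigma>l \<sigma>u p = \<sigma>\<^sup>2 / 2 * p"
  by (cases "0 \<le> p") (auto simp: G_fun_def)

lemma G_fun_upper:
  assumes "0 \<le> \<sigma>l" "\<sigma> \<in> {\<sigma>l..\<sigma>u}"
  shows "\<sigma>\<^sup>2 / 2 * p \<le> G_fun \<sigma>l \<sigma>u p"
proof (cases "0 \<le> p")
  case True
  have "\<sigma>\<^sup>2 \<le> \<sigma>u\<^sup>2" using assms by (intro power_mono) auto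
  then show ?thesis using True by (simp add: G_fun_def mult_right_mono)
next
  case False
  have "\<sigma>l\<^sup>2 \<le> \<sigma>\<^sup>2" using assms by (intro power_mono) auto
  then show ?thesis using False by (simp add: G_fun_def mult_right_mono_neg)
qed

lemma G_fun_mono:
  assumes "0 \<le> \<sigma>l" "\<sigma>l \<le> \<sigma>u" "p \<le> q"
  shows "G_fun \<sigma>l \<sigma>u p \<le> G_fun \<sigma>l \<sigma>u q"
proof -
  obtain \<sigma> where \<sigma>: "\<sigma> \<in> {\<sigma>l, \<sigma>u}" "G_fun \<sigma>l \<sigma>u p = \<sigma>\<^sup>2 / 2 * p"
    by (rule G_fun_attained)
  note \<sigma>(2)
  also have "\<sigma>\<^sup>2 / 2 * p \<le> \<sigma>\<^sup>2 / 2 * q" using assms by (intro mult_left_mono) auto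
  also have "\<dots> \<le> G_fun \<sigma>l \<sigma>u q" using \<sigma>(1) assms by (intro G_fun_upper) auto
  finally show ?thesis .
qed

lemma G_fun_add_le:
  assumes "0 \<le> \<sigma>l" "\<sigma>l \<le> \<sigma>u" "0 \<le> q"
  shows "G_fun \<sigma>l \<sigma>u (p + q) \<le> G_fun \<sigma>l \<sigma>u p + \<sigma>u\<^sup>2 / 2 * q"
proof -
  obtain \<sigma> where \<sigma>: "\<sigma> \<in> {\<sigma>l, \<sigma>u}" "G_fun \<sigma>l \<sigma>u (p + q) = \<sigma>\<^sup>2 / 2 * (p + q)"
    by (rule G_fun_attained)
  have "\<sigma>\<^sup>2 \<le> \<sigma>u\<^sup>2" using \<sigma>(1) assms by (intro power_mono) auto
  then have "\<sigma>\<^sup>2 / 2 * q \<le> \<sigma>u\<^sup>2 / 2 * q" using assms by (intro mult_right_mono) auto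
  moreover have "\<sigma>\<^sup>2 / 2 * p \<le> G_fun \<sigma>l \<sigma>u p" using \<sigma>(1) assms by (intro G_fun_upper) auto
  ultimately show ?thesis using \<sigma>(2) by (simp add: distrib_left)
qed

text \<open>Time runs backwards: the interpolant equals the mollified \<open>f\<close> at
  \<open>s = b\<close> and the mollified successor \<open>g\<close> at
  \<open>s = b - \<delta>\<close>, hence the minus sign in the time derivative.\<close>

lemma C12_on_interpolation:
  assumes f: "bdd_lip B L f" and g: "bdd_lip B L g" and \<epsilon>: "0 < \<epsilon>" and \<delta>: "0 < \<delta>"
  shows "C12_on U (\<lambda>s x. mollify \<epsilon> f x + (b - s) / \<delta> * (mollify \<epsilon> g x - mollify \<epsilon> f x))
    (\<lambda>s x. - (mollify \<epsilon> g x - mollify \<epsilon> f x) / \<delta>)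
    (\<lambda>s x. mollify_D1 \<epsilon> f x + (b - s) / \<delta> * (mollify_D1 \<epsilon> g x - mollify_D1 \<epsilon> f x))
    (\<lambda>s x. mollify_D2 \<epsilon> f x + (b - s) / \<delta> * (mollify_D2 \<epsilon> g x - mollify_D2 \<epsilon> f x))"
    and "continuous_on U (\<lambda>(s, x). mollify \<epsilon> f x + (b - s) / \<delta> * (mollify \<epsilon> g x - mollify \<epsilon> f x))"
proof -
  have c: "continuous_on U (\<lambda>z. h (snd z))" if "\<And>x. isCont h x" for h :: "real \<Rightarrow> real"
    by (rule continuous_on_compose2[of UNIV h]) (auto intro!: continuous_intros simp: continuous_on_eq_continuous_at that)
  have 0: "continuous_on U (\<lambda>z. mollify \<epsilon> h (snd z))" if "bdd_lip B L h" for h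
    by (intro c DERIV_isCont[OF mollify_DERIV(1)[OF that \<epsilon>]])
  have 1: "continuous_on U (\<lambda>z. mollify_D1 \<epsilon> h (snd z))" if "bdd_lip B L h" for h
    by (intro c DERIV_isCont[OF mollify_DERIV(2)[OF that \<epsilon>]])
  have 2: "continuous_on U (\<lambda>z. mollify_D2 \<epsilon> h (snd z))" if "bdd_lip B L h" for h
  proof (rule c)
    fix x
    have "bdd_lip B L (\<lambda>x. h (x + a))" for a
      using that unfolding bdd_lip_def by (metis add_diff_cancel_right)
    from bdd_lip_isCont[OF this[of "2 * \<epsilon>"]] bdd_lip_isCont[OF this[of "- (2 * \<epsilon>)"]]
    show "isCont (mollify_D2 \<epsilon> h) x"
      unfolding mollify_D2_def using \<epsilon> bdd_lip_isCont[OF that] by (auto intro!: continuous_intros)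
  qed
  show "continuous_on U (\<lambda>(s, x). mollify \<epsilon> f x + (b - s) / \<delta> * (mollify \<epsilon> g x - mollify \<epsilon> f x))"
    using \<delta> by (auto simp: case_prod_unfold intro!: continuous_intros 0[OF f] 0[OF g])
  moreover have "((\<lambda>s. mollify \<epsilon> f x + (b - s) / \<delta> * (mollify \<epsilon> g x - mollify \<epsilon> f x)) has_real_derivative
      - (mollify \<epsilon> g x - mollify \<epsilon> f x) / \<delta>) (at s)" for s x
  proof -
    have "((\<lambda>s. (b - s) / \<delta>) has_real_derivative - 1 / \<delta>) (at s)"
      using \<delta> by (auto intro!: derivative_eq_intros)
    from DERIV_add[OF DERIV_const[of "mollify \<epsilon> f x"] DERIV_cmult_right[OF this, of "mollify \<epsilon> g x - mollify \<epsilon> f x"]]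
    show ?thesis using \<delta> by (elim DERIV_cong) (simp add: field_simps)
  qed
  moreover have "((\<lambda>x. mollify \<epsilon> f x + (b - s) / \<delta> * (mollify \<epsilon> g x - mollify \<epsilon> f x)) has_real_derivative
      mollify_D1 \<epsilon> f x + (b - s) / \<delta> * (mollify_D1 \<epsilon> g x - mollify_D1 \<epsilon> f x)) (at x)" for s x
    by (intro DERIV_add DERIV_cmult DERIV_diff mollify_DERIV[OF f \<epsilon>] mollify_DERIV[OF g \<epsilon>])
  moreover have "((\<lambda>x. mollify_D1 \<epsilon> f x + (b - s) / \<delta> * (mollify_D1 \<epsilon> g x - mollify_D1 \<epsilon> f x)) has_real_derivative
      mollify_D2 \<epsilon> f x + (b - s) / \<delta> * (mollify_D2 \<epsilon> g x - mollify_D2 \<epsilon> f x)) (at x)" for s x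
    by (intro DERIV_add DERIV_cmult DERIV_diff mollify_DERIV[OF f \<epsilon>] mollify_DERIV[OF g \<epsilon>])
  ultimately show "C12_on U (\<lambda>s x. mollify \<epsilon> f x + (b - s) / \<delta> * (mollify \<epsilon> g x - mollify \<epsilon> f x))
    (\<lambda>s x. - (mollify \<epsilon> g x - mollify \<epsilon> f x) / \<delta>)
    (\<lambda>s x. mollify_D1 \<epsilon> f x + (b - s) / \<delta> * (mollify_D1 \<epsilon> g x - mollify_D1 \<epsilon> f x))
    (\<lambda>s x. mollify_D2 \<epsilon> f x + (b - s) / \<delta> * (mollify_D2 \<epsilon> g x - mollify_D2 \<epsilon> f x))"
    unfolding C12_on_def using \<delta>
    by (auto simp: case_prod_unfold intro!: continuous_intros 0[OF f] 0[OF g] 1[OF f] 1[OF g] 2[OF f] 2[OF g])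
qed

text \<open>Only one volatility matters at a given x: the one attaining G at the second derivative
  of the mollified \<open>f\<close>. For it, \<open>step\<close> commuted with the mollifier and
  expanded by Taylor bounds the time difference quotient from below by that value of G, up to an
  error of order sqrt \<delta>.\<close>

lemma interpolation_supersolution:
  assumes \<sigma>: "0 \<le> \<sigma>l" "\<sigma>l \<le> \<sigma>u" and \<epsilon>: "0 < \<epsilon>" and \<delta>: "0 < \<delta>" and r: "0 \<le> r" "r \<le> 1"
    and f: "bdd_lip B L f" and g: "bdd_lip B L g"
    and step: "\<And>\<sigma> x. \<sigma> \<in> {\<sigma>l..\<sigma>u} \<Longrightarrow> avg std_normal_distribution (\<sigma> * sqrt \<delta>) f x \<le> g x"
    and near: "\<And>x. \<bar>g x - f x\<bar> \<le> L * (\<sigma>u * sqrt \<delta>)"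
  shows "- (mollify \<epsilon> g x - mollify \<epsilon> f x) / \<delta> +
      G_fun \<sigma>l \<sigma>u (mollify_D2 \<epsilon> f x + r * (mollify_D2 \<epsilon> g x - mollify_D2 \<epsilon> f x)) \<le>
      2 * L * \<sigma>u ^ 3 / \<epsilon>\<^sup>2 * sqrt \<delta>"
proof -
  obtain \<sigma> where \<sigma>0: "\<sigma> \<in> {\<sigma>l, \<sigma>u}" and
    G: "G_fun \<sigma>l \<sigma>u (mollify_D2 \<epsilon> f x) = \<sigma>\<^sup>2 / 2 * mollify_D2 \<epsilon> f x"
    by (rule G_fun_attained)
  have \<sigma>1: "0 \<le> \<sigma>" "\<sigma> \<le> \<sigma>u" "\<sigma> \<in> {\<sigma>l..\<sigma>u}" using \<sigma>0 \<sigma> by auto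
  have L: "0 \<le> L" by (rule bdd_lip_nonneg[OF f])
  let ?s = "\<sigma> * sqrt \<delta>"
  have \<delta>2: "sqrt \<delta> * sqrt \<delta> = \<delta>" using \<delta> by simp
  have "mollify \<epsilon> f x + mollify_D2 \<epsilon> f x / 2 * ?s\<^sup>2 - L / \<epsilon>\<^sup>2 * ?s ^ 3 \<le> avg std_normal_distribution ?s (mollify \<epsilon> f) x"
    using \<sigma>1 \<delta> by (intro avg_taylor2_lower[OF mollify_bdd_lip[OF f] mollify_DERIV[OF f \<epsilon>] mollify_D2_lipschitz[OF f \<epsilon>]]) auto
  also have "\<dots> = mollify \<epsilon> (avg std_normal_distribution ?s f) x"
    by (simp add: mollify_avg[OF real_dist_normal_dist f])
  also have "\<dots> \<le> mollify \<epsilon> g x"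
    by (intro mollify_mono[OF std_normal.avg_bdd_lip[OF f] g] step \<sigma>1)
  finally have main: "mollify_D2 \<epsilon> f x / 2 * ?s\<^sup>2 - L / \<epsilon>\<^sup>2 * ?s ^ 3 \<le> mollify \<epsilon> g x - mollify \<epsilon> f x" by simp
  have sq: "?s\<^sup>2 = \<sigma>\<^sup>2 * \<delta>" "?s ^ 3 = \<sigma> ^ 3 * sqrt \<delta> * \<delta>"
    using \<delta>2 by (auto simp: power2_eq_square power3_eq_cube)
  from main[unfolded sq] have "(\<sigma>\<^sup>2 / 2 * mollify_D2 \<epsilon> f x - L / \<epsilon>\<^sup>2 * (\<sigma> ^ 3 * sqrt \<delta>)) * \<delta> \<le> mollify \<epsilon> g x - mollify \<epsilon> f x"
    by (simp add: algebra_simps)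
  then have "\<sigma>\<^sup>2 / 2 * mollify_D2 \<epsilon> f x - L / \<epsilon>\<^sup>2 * (\<sigma> ^ 3 * sqrt \<delta>) \<le> (mollify \<epsilon> g x - mollify \<epsilon> f x) / \<delta>"
    using \<delta> by (simp add: pos_le_divide_eq)
  moreover have "L / \<epsilon>\<^sup>2 * (\<sigma> ^ 3 * sqrt \<delta>) \<le> L / \<epsilon>\<^sup>2 * (\<sigma>u ^ 3 * sqrt \<delta>)"
    using L \<sigma>1 \<delta> by (intro mult_left_mono mult_right_mono power_mono) auto
  \<comment> \<open>The second derivatives of the two ends differ by at most L \<sigma>u sqrt
    \<delta> / \<epsilon>^2, by \<open>near\<close>. Evaluating G in between therefore costs no more
    than the Taylor error; the two errors together give the factor 2 in the claim.\<close>
  moreover have "G_fun \<sigma>l \<sigma>u (mollify_D2 \<epsilon> f x + r * (mollify_D2 \<epsilon> g x - mollify_D2 \<epsilon> f x)) \<le>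
    \<sigma>\<^sup>2 / 2 * mollify_D2 \<epsilon> f x + L / \<epsilon>\<^sup>2 * (\<sigma>u ^ 3 * sqrt \<delta>)"
  proof -
    let ?d = "\<bar>mollify_D2 \<epsilon> g x - mollify_D2 \<epsilon> f x\<bar>"
    have "r * (mollify_D2 \<epsilon> g x - mollify_D2 \<epsilon> f x) \<le> 1 * ?d"
      by (rule order_trans[OF mult_left_mono[OF abs_ge_self r(1)] mult_right_mono[OF r(2) abs_ge_zero]])
    then have "G_fun \<sigma>l \<sigma>u (mollify_D2 \<epsilon> f x + r * (mollify_D2 \<epsilon> g x - mollify_D2 \<epsilon> f x)) \<le>
        G_fun \<sigma>l \<sigma>u (mollify_D2 \<epsilon> f x + ?d)"
      using \<sigma> by (intro G_fun_mono) auto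
    also have "\<dots> \<le> \<sigma>\<^sup>2 / 2 * mollify_D2 \<epsilon> f x + \<sigma>u\<^sup>2 / 2 * ?d"
      using G_fun_add_le[OF \<sigma>, of ?d "mollify_D2 \<epsilon> f x"] G by simp
    also have "\<sigma>u\<^sup>2 / 2 * ?d \<le> \<sigma>u\<^sup>2 * (L * (\<sigma>u * sqrt \<delta>) / \<epsilon>\<^sup>2)"
      using mollify_D2_dist[where f = g and g = f and e = "L * (\<sigma>u * sqrt \<delta>)" and x = x, OF near \<epsilon>] by (intro mult_mono) auto
    also have "\<dots> = L / \<epsilon>\<^sup>2 * (\<sigma>u ^ 3 * sqrt \<delta>)" by (simp add: power2_eq_square power3_eq_cube)
    finally show ?thesis by simp
  qed
  moreover have "2 * L * \<sigma>u ^ 3 / \<epsilon>\<^sup>2 * sqrt \<delta> = L / \<epsilon>\<^sup>2 * (\<sigma>u ^ 3 * sqrt \<delta>) + L / \<epsilon>\<^sup>2 * (\<sigma>u ^ 3 * sqrt \<delta>)"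
    by simp
  moreover have "- (mollify \<epsilon> g x - mollify \<epsilon> f x) / \<delta> = - ((mollify \<epsilon> g x - mollify \<epsilon> f x) / \<delta>)"
    by (rule minus_divide_left[symmetric])
  ultimately show ?thesis by linarith
qed

text \<open>Comparison is applied on n consecutive strips of width \<delta>, backwards from
  \<open>b\<close>, each starting from the error of the previous one; the residuals \<kappa>
  \<delta> add up to \<kappa> (b - a). The chain stays mollified throughout, so the two conversions,
  at \<open>b\<close> and at \<open>a\<close>, account for 4 * L * \<epsilon>. The chain
  \<open>v\<close> is left abstract because it is instantiated both by the scheme and by an exact
  heat flow.\<close>

lemma viscosity_subsolution_le_chain:
  fixes v :: "nat \<Rightarrow> real \<Rightarrow> real"
  assumes ab: "0 \<le> a" "a < b" "b \<le> 1" and \<sigma>: "0 \<le> \<sigma>l" "\<sigma>l \<le> \<sigma>u" and \<epsilon>: "0 < \<epsilon>"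
    and n: "0 < n" and \<delta>_def: "\<delta> = (b - a) / real n"
    and u: "continuous_on ({a..b} \<times> UNIV) (\<lambda>(t, x). u t x)" "viscosity_subsolution (G_fun \<sigma>l \<sigma>u) u"
    and u_bdd: "\<And>t x. a \<le> t \<Longrightarrow> t \<le> b \<Longrightarrow> u t x \<le> B"
    and v0: "\<And>x. u b x \<le> v 0 x"
    and v: "\<And>k. k \<le> n \<Longrightarrow> bdd_lip B L (v k)"
    and step: "\<And>k \<sigma> x. k < n \<Longrightarrow> \<sigma> \<in> {\<sigma>l..\<sigma>u} \<Longrightarrow> avg std_normal_distribution (\<sigma> * sqrt \<delta>) (v k) x \<le> v (Suc k) x"
    and near: "\<And>k x. k < n \<Longrightarrow> \<bar>v (Suc k) x - v k x\<bar> \<le> L * (\<sigma>u * sqrt \<delta>)"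
  shows "u a x \<le> v n x + 4 * L * \<epsilon> + 2 * L * \<sigma>u ^ 3 / \<epsilon>\<^sup>2 * sqrt \<delta> * (b - a)"
proof -
  have \<delta>: "0 < \<delta>" using ab n by (simp add: \<delta>_def)
  define \<kappa> where "\<kappa> = 2 * L * \<sigma>u ^ 3 / \<epsilon>\<^sup>2 * sqrt \<delta>"
  have n\<delta>: "real n * \<delta> = b - a" using n by (simp add: \<delta>_def)
  have "u (b - real k * \<delta>) x \<le> mollify \<epsilon> (v k) x + 2 * L * \<epsilon> + \<kappa> * (real k * \<delta>)" if "k \<le> n" for k x
    using that
  proof (induction k arbitrary: x)
    case 0
    then show ?case using v0[of x] mollify_near[OF v[of 0] \<epsilon>, of x] by simp
  next
    case (Suc k)
    let ?b = "b - real k * \<delta>" and ?a = "b - real (Suc k) * \<delta>"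
    let ?w = "\<lambda>s x. mollify \<epsilon> (v k) x + (?b - s) / \<delta> * (mollify \<epsilon> (v (Suc k)) x - mollify \<epsilon> (v k) x)"
    have "real (Suc k) * \<delta> \<le> real n * \<delta>" using Suc.prems \<delta> by (intro mult_right_mono) auto
    then have a': "a \<le> ?a" using n\<delta> by simp
    have b': "?b \<le> b" using \<delta> by simp
    have ab': "?b - ?a = \<delta>" by (simp add: algebra_simps)
    have vk: "bdd_lip B L (v k)" "bdd_lip B L (v (Suc k))" using Suc.prems by (auto intro: v)
    have r: "0 \<le> (?b - s) / \<delta>" "(?b - s) / \<delta> \<le> 1" if "?a \<le> s" "s \<le> ?b" for s
      using that \<delta> ab' by (auto simp: divide_le_eq)
    have "u ?a x \<le> ?w ?a x + (2 * L * \<epsilon> + \<kappa> * (real k * \<delta>)) + \<kappa> * (?b - ?a)"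
    proof (rule viscosity_subsolution_le_supersolution[where a = ?a and b = ?b and u = u and w = ?w
          and c = "2 * L * \<epsilon> + \<kappa> * (real k * \<delta>)" and \<kappa> = \<kappa> and G = "G_fun \<sigma>l \<sigma>u" and \<Lambda> = "\<sigma>u\<^sup>2 / 2"
          and B = "B + (B + (B + B))"])
      show "0 \<le> ?a" "?b \<le> 1" using a' b' ab by linarith+
      show "?a < ?b" using ab' \<delta> by linarith
      show "G_fun \<sigma>l \<sigma>u p \<le> G_fun \<sigma>l \<sigma>u q" if "p \<le> q" for p q by (rule G_fun_mono[OF \<sigma> that])
      show "G_fun \<sigma>l \<sigma>u (p + q) \<le> G_fun \<sigma>l \<sigma>u p + \<sigma>u\<^sup>2 / 2 * q" if "0 \<le> q" for p q
        by (rule G_fun_add_le[OF \<sigma> that])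
      show "continuous_on ({?a..?b} \<times> UNIV) (\<lambda>(t, x). u t x)"
        by (rule continuous_on_subset[OF u(1)]) (use a' b' in auto)
      show "viscosity_subsolution (G_fun \<sigma>l \<sigma>u) u" by (rule u(2))
      show "continuous_on ({?a..?b} \<times> UNIV) (\<lambda>(s, x). ?w s x)"
        by (rule C12_on_interpolation(2)[OF vk \<epsilon> \<delta>])
      show "C12_on ({?a<..<?b} \<times> UNIV) ?w
        (\<lambda>s x. - (mollify \<epsilon> (v (Suc k)) x - mollify \<epsilon> (v k) x) / \<delta>)
        (\<lambda>s x. mollify_D1 \<epsilon> (v k) x + (?b - s) / \<delta> * (mollify_D1 \<epsilon> (v (Suc k)) x - mollify_D1 \<epsilon> (v k) x))
        (\<lambda>s x. mollify_D2 \<epsilon> (v k) x + (?b - s) / \<delta> * (mollify_D2 \<epsilon> (v (Suc k)) x - mollify_D2 \<epsilon> (v k) x))"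
        by (rule C12_on_interpolation(1)[OF vk \<epsilon> \<delta>])
      show "- (mollify \<epsilon> (v (Suc k)) x - mollify \<epsilon> (v k) x) / \<delta> +
        G_fun \<sigma>l \<sigma>u (mollify_D2 \<epsilon> (v k) x + (?b - s) / \<delta> * (mollify_D2 \<epsilon> (v (Suc k)) x - mollify_D2 \<epsilon> (v k) x)) \<le> \<kappa>"
        if s: "?a < s" "s < ?b" for s x
        unfolding \<kappa>_def
        by (rule interpolation_supersolution[OF \<sigma> \<epsilon> \<delta> r vk step near]) (use s Suc.prems in auto)
      show "u s x - ?w s x \<le> B + (B + (B + B))" if s: "?a \<le> s" "s \<le> ?b" for s x
      proof -
        have m: "\<bar>mollify \<epsilon> (v k) x\<bar> \<le> B" "\<bar>mollify \<epsilon> (v (Suc k)) x\<bar> \<le> B"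
          using vk by (auto intro: bdd_lipD mollify_bdd_lip)
        have h: "\<bar>(?b - s) / \<delta> * (mollify \<epsilon> (v (Suc k)) x - mollify \<epsilon> (v k) x)\<bar> \<le> 1 * (B + B)"
          unfolding abs_mult using m r[OF s] by (intro mult_mono) auto
        moreover have "u s x \<le> B" using s a' b' by (intro u_bdd) auto
        moreover have "U - (M + R) \<le> B + (B + (B + B))" if "U \<le> B" "\<bar>M\<bar> \<le> B" "\<bar>R\<bar> \<le> 1 * (B + B)" for U M R
          using that(1) abs_le_D2[OF that(2)] abs_le_D2[OF that(3)] by simp
        ultimately show ?thesis using m(1) by blast
      qed
      show "u ?b x \<le> ?w ?b x + (2 * L * \<epsilon> + \<kappa> * (real k * \<delta>))" for x
        using Suc.IH[of x] Suc.prems by simp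
    qed
    also have "?w ?a x = mollify \<epsilon> (v (Suc k)) x" using \<delta> by (simp add: ab' del: of_nat_Suc)
    finally show ?case by (simp add: ab' algebra_simps)
  qed
  from this[of n x] have "u a x \<le> mollify \<epsilon> (v n) x + 2 * L * \<epsilon> + \<kappa> * (b - a)" by (simp add: n\<delta>)
  then show ?thesis using mollify_near[OF v[of n] \<epsilon>, of x] unfolding \<kappa>_def by simp
qed

section \<open>Bounds on the scheme by viscosity solutions\<close>

lemma avg_std_normal_0: "avg std_normal_distribution 0 f x = f x"
  using std_normal.prob_space by (simp add: avg_def)

lemma avg_std_normal_eq_density:
  assumes "0 < s" and [measurable]: "f \<in> borel_measurable borel"
  shows "avg std_normal_distribution s f x = (\<integral>y. f (x + y) \<partial>density lborel (normal_density 0 s))"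
proof -
  have "(\<integral>y. f (x + y) \<partial>normal_law 0 (s\<^sup>2)) = avg std_normal_distribution s (\<lambda>y. f (x + y)) 0"
    using assms(1) by (intro integral_normal_law) auto
  then show ?thesis using assms(1) by (simp add: normal_law_def avg_def)
qed

text \<open>Variances of independent centred normal variables add. Zero scales are split off because
  the convolution formula needs densities.\<close>

lemma avg_std_normal_semigroup:
  assumes f: "bdd_lip B L f" and s: "0 \<le> s" and r: "0 \<le> r"
  shows "avg std_normal_distribution s (avg std_normal_distribution r f) x =
    avg std_normal_distribution (sqrt (s\<^sup>2 + r\<^sup>2)) f x"
proof (cases "s = 0 \<or> r = 0")
  case True
  have "avg std_normal_distribution 0 g = g" for g by (rule ext) (rule avg_std_normal_0)
  with True s r show ?thesis by auto
next
  case False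
  with s r have s: "0 < s" and r: "0 < r" by auto
  let ?D = "\<lambda>s. density lborel (\<lambda>x. ennreal (normal_density 0 s x))"
  interpret S: prob_space "?D s" by (rule prob_space_normal_density[OF s])
  interpret R: prob_space "?D r" by (rule prob_space_normal_density[OF r])
  interpret pair_prob_space "?D s" "?D r" ..
  have [measurable]: "f \<in> borel_measurable borel" by (rule bdd_lip_measurable[OF f])
  have [measurable]: "avg std_normal_distribution r f \<in> borel_measurable borel"
    by (rule bdd_lip_measurable[OF std_normal.avg_bdd_lip[OF f]])
  have "?D s \<star> ?D r = density lborel (\<lambda>x. \<integral>\<^sup>+y. ennreal (normal_density 0 s (x - y)) * ennreal (normal_density 0 r y) \<partial>lborel)"
    by (rule convolution_density) (auto intro: S.finite_measure_axioms R.finite_measure_axioms)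
  then have conv: "?D s \<star> ?D r = ?D (sqrt (s\<^sup>2 + r\<^sup>2))"
    using conv_normal_density_zero_mean[OF s r] by (simp add: ennreal_mult'[symmetric])
  have int: "integrable (?D s \<Otimes>\<^sub>M ?D r) (\<lambda>(y, z). f (x + (y + z)))"
    by (rule integrable_const_bound[where B=B]) (auto intro!: AE_I2 bdd_lipD[OF f] split: prod.splits)
  have "avg std_normal_distribution (sqrt (s\<^sup>2 + r\<^sup>2)) f x = (\<integral>w. f (x + w) \<partial>(?D s \<star> ?D r))"
    unfolding conv using s by (intro avg_std_normal_eq_density) (auto simp: sum_power2_gt_zero_iff)
  also have "\<dots> = (\<integral>p. f (x + (fst p + snd p)) \<partial>(?D s \<Otimes>\<^sub>M ?D r))"
    unfolding convolution_def by (subst integral_distr) (auto simp: case_prod_unfold)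
  also have "\<dots> = (\<integral>y. \<integral>z. f (x + (y + z)) \<partial>?D r \<partial>?D s)"
    using integral_fst'[OF int] by (simp add: case_prod_unfold)
  also have "\<dots> = (\<integral>y. avg std_normal_distribution r f (x + y) \<partial>?D s)"
    using r by (simp add: avg_std_normal_eq_density add.assoc)
  also have "\<dots> = avg std_normal_distribution s (avg std_normal_distribution r f) x"
    using s by (simp add: avg_std_normal_eq_density)
  finally show ?thesis by simp
qed

text \<open>Order of choice: \<epsilon> first makes the mollification error small, then n makes the
  consistency error small for that \<epsilon>. The summand 1 in the denominator
  \<open>4 * L + 1\<close> covers \<open>L = 0\<close>.\<close>

lemma chain_error_small:
  fixes K L d e :: real
  assumes "0 < e" "0 \<le> L"
  obtains \<epsilon> where "0 < \<epsilon>" "\<forall>\<^sub>F n in sequentially. 4 * L * \<epsilon> + K / \<epsilon>\<^sup>2 * sqrt (d / real n) * d < e"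
proof
  define \<epsilon> where "\<epsilon> = e / (4 * L + 1) / 2"
  show \<epsilon>: "0 < \<epsilon>" using assms by (simp add: \<epsilon>_def)
  have "4 * L * \<epsilon> < e" using assms by (simp add: \<epsilon>_def field_simps add_pos_nonneg mult_pos_pos)
  moreover have "(\<lambda>n. 4 * L * \<epsilon> + K / \<epsilon>\<^sup>2 * sqrt (d / real n) * d) \<longlonglongrightarrow> 4 * L * \<epsilon> + K / \<epsilon>\<^sup>2 * sqrt 0 * d"
    by (intro tendsto_intros lim_const_over_n)
  ultimately show "\<forall>\<^sub>F n in sequentially. 4 * L * \<epsilon> + K / \<epsilon>\<^sup>2 * sqrt (d / real n) * d < e"
    by (auto dest!: order_tendstoD(2))
qed

text \<open>G dominates the linear map p \<mapsto> \<sigma>^2 / 2 * p, so u is a supersolution of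
  that linear equation; the linear map is odd, so -u is a subsolution of the same equation.
  \<open>G_fun \<sigma> \<sigma>\<close> is this linear map.\<close>

lemma viscosity_supersolution_uminus:
  assumes u: "viscosity_supersolution (G_fun \<sigma>l \<sigma>u) u" and "0 \<le> \<sigma>l" "\<sigma> \<in> {\<sigma>l..\<sigma>u}"
  shows "viscosity_subsolution (G_fun \<sigma> \<sigma>) (\<lambda>t x. - u t x)"
  unfolding viscosity_subsolution_def
proof (intro allI impI, elim conjE)
  fix U \<psi> \<psi>t \<psi>x \<psi>xx t x
  assume U: "open U" "U \<subseteq> {0<..<1} \<times> (UNIV :: real set)" "(t, x) \<in> U"
    and C: "C12_on U \<psi> \<psi>t \<psi>x \<psi>xx" and max: "\<forall>(s, y)\<in>U. - u s y - \<psi> s y \<le> - u t x - \<psi> t x"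
  have C': "C12_on U (\<lambda>s y. - \<psi> s y) (\<lambda>s y. - \<psi>t s y) (\<lambda>s y. - \<psi>x s y) (\<lambda>s y. - \<psi>xx s y)"
    using C unfolding C12_on_def case_prod_unfold by (auto intro!: DERIV_minus continuous_on_minus)
  have "- \<psi>t t x + G_fun \<sigma>l \<sigma>u (- \<psi>xx t x) \<le> 0"
    using u[unfolded viscosity_supersolution_def, rule_format, of U t x "\<lambda>s y. - \<psi> s y" "\<lambda>s y. - \<psi>t s y"
      "\<lambda>s y. - \<psi>x s y" "\<lambda>s y. - \<psi>xx s y"] U C' max by fastforce
  moreover have "\<sigma>\<^sup>2 / 2 * (- \<psi>xx t x) \<le> G_fun \<sigma>l \<sigma>u (- \<psi>xx t x)" by (rule G_fun_upper) fact+
  moreover obtain \<sigma>' where "\<sigma>' \<in> {\<sigma>, \<sigma>}" "G_fun \<sigma> \<sigma> (\<psi>xx t x) = \<sigma>'\<^sup>2 / 2 * \<psi>xx t x" by (rule G_fun_attained)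
  ultimately show "0 \<le> \<psi>t t x + G_fun \<sigma> \<sigma> (\<psi>xx t x)" by simp
qed

lemma bdd_lip_uminus: "bdd_lip B L f \<Longrightarrow> bdd_lip B L (\<lambda>x. - f x)"
  by (simp add: bdd_lip_def abs_minus_commute)

text \<open>
  The upper bound for subsolutions, applied to \<open>- u\<close> with the linear equation of volatility \<open>\<sigma>\<close>; by the
  semigroup property the approximating chain is the exact heat flow for every number of steps.
\<close>

lemma viscosity_supersolution_ge_avg:
  assumes ab: "0 \<le> a" "a < b" "b \<le> 1" and \<sigma>: "0 \<le> \<sigma>l" "\<sigma> \<in> {\<sigma>l..\<sigma>u}"
    and u: "continuous_on ({a..b} \<times> UNIV) (\<lambda>(t, x). u t x)" "viscosity_supersolution (G_fun \<sigma>l \<sigma>u) u"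
    and u_bdd: "\<And>t x. a \<le> t \<Longrightarrow> t \<le> b \<Longrightarrow> \<bar>u t x\<bar> \<le> B"
    and ub: "bdd_lip B L (u b)"
  shows "avg std_normal_distribution (\<sigma> * sqrt (b - a)) (u b) x \<le> u a x"
proof (rule field_le_epsilon)
  fix e :: real assume e: "0 < e"
  have \<sigma>0: "0 \<le> \<sigma>" using \<sigma> by auto
  let ?f = "\<lambda>x. - u b x"
  have f: "bdd_lip B L ?f" by (rule bdd_lip_uminus[OF ub])
  have L: "0 \<le> L" by (rule bdd_lip_nonneg[OF f])
  obtain \<epsilon> where \<epsilon>: "0 < \<epsilon>" and
    ev: "\<forall>\<^sub>F n in sequentially. 4 * L * \<epsilon> + 2 * L * \<sigma> ^ 3 / \<epsilon>\<^sup>2 * sqrt ((b - a) / real n) * (b - a) < e"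
    using chain_error_small[OF e L] by blast
  obtain n where n: "0 < n" and
    err: "4 * L * \<epsilon> + 2 * L * \<sigma> ^ 3 / \<epsilon>\<^sup>2 * sqrt ((b - a) / real n) * (b - a) < e"
    using eventually_happens'[OF sequentially_bot eventually_conj[OF ev eventually_gt_at_top[of 0]]] by blast
  define \<delta> where "\<delta> = (b - a) / real n"
  have \<delta>: "0 < \<delta>" using ab n by (simp add: \<delta>_def)
  define v where "v = (\<lambda>k::nat. avg std_normal_distribution (\<sigma> * sqrt (real k * \<delta>)) ?f)"
  have v: "bdd_lip B L (v k)" for k unfolding v_def by (rule std_normal.avg_bdd_lip[OF f])
  have v_Suc: "v (Suc k) x = avg std_normal_distribution (\<sigma> * sqrt \<delta>) (v k) x" for k x
  proof -
    have "sqrt ((\<sigma> * sqrt \<delta>)\<^sup>2 + (\<sigma> * sqrt (real k * \<delta>))\<^sup>2) = sqrt (\<sigma>\<^sup>2 * (real (Suc k) * \<delta>))"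
      using \<delta> by (simp add: power_mult_distrib algebra_simps)
    also have "\<dots> = \<sigma> * sqrt (real (Suc k) * \<delta>)" using \<sigma>0 by (simp only: real_sqrt_mult real_sqrt_abs abs_of_nonneg)
    finally show ?thesis unfolding v_def
      using \<sigma>0 \<delta> by (subst avg_std_normal_semigroup[OF f]) (simp_all del: of_nat_Suc)
  qed
  have "- u a x \<le> v n x + 4 * L * \<epsilon> + 2 * L * \<sigma> ^ 3 / \<epsilon>\<^sup>2 * sqrt \<delta> * (b - a)"
  proof (rule viscosity_subsolution_le_chain[OF ab \<sigma>0 order_refl \<epsilon> n \<delta>_def, where u = "\<lambda>t x. - u t x" and B = B])
    show "continuous_on ({a..b} \<times> UNIV) (\<lambda>(t, x). - u t x)"
      using continuous_on_minus[OF u(1)] by (simp add: case_prod_unfold)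
    show "viscosity_subsolution (G_fun \<sigma> \<sigma>) (\<lambda>t x. - u t x)"
      by (rule viscosity_supersolution_uminus[OF u(2) \<sigma>])
    show "- u t x \<le> B" if "a \<le> t" "t \<le> b" for t x using u_bdd[OF that, of x] by simp
    show "- u b x \<le> v 0 x" for x by (simp add: v_def avg_std_normal_0)
    show "bdd_lip B L (v k)" for k by (rule v)
    show "avg std_normal_distribution (\<sigma>' * sqrt \<delta>) (v k) x \<le> v (Suc k) x" if "\<sigma>' \<in> {\<sigma>..\<sigma>}" for k \<sigma>' x
      using that by (simp add: v_Suc)
    show "\<bar>v (Suc k) x - v k x\<bar> \<le> L * (\<sigma> * sqrt \<delta>)" for k x
      unfolding v_Suc using std_normal.avg_near[OF v std_normal_abs, of "\<sigma> * sqrt \<delta>" k x] \<sigma>0 \<delta> by simp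
  qed
  moreover have "v n x = - avg std_normal_distribution (\<sigma> * sqrt (b - a)) (u b) x"
    using n by (simp add: v_def \<delta>_def avg_def)
  ultimately show "avg std_normal_distribution (\<sigma> * sqrt (b - a)) (u b) x \<le> u a x + e"
    using err by (simp add: \<delta>_def)
qed

text \<open>The constants depend neither on \<open>n\<close> nor on \<open>i\<close>, which allows a
  fixed mollification width as n grows. The Lipschitz bound again uses the maximizer at one point as
  competitor at the other.\<close>

lemma phi_scheme_bdd_lip:
  assumes \<phi>: "bdd_lip B L \<phi>" and \<sigma>: "0 \<le> \<sigma>l" "\<sigma>l \<le> \<sigma>u"
  shows "bdd_lip B L (phi_scheme \<sigma>l \<sigma>u \<phi> n i)"
proof (induction i)
  case (Suc i)
  let ?f = "phi_scheme \<sigma>l \<sigma>u \<phi> n i" and ?g = "phi_scheme \<sigma>l \<sigma>u \<phi> n (Suc i)"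
  let ?P = "\<lambda>v. avg std_normal_distribution (v / sqrt n) ?f"
  note step = phi_scheme_step[OF bdd_lip_exp_lip[OF Suc.IH] \<sigma>]
  have avg: "bdd_lip B L (?P v)" for v by (rule std_normal.avg_bdd_lip[OF Suc.IH])
  have le: "?g x \<le> ?g y + L * \<bar>x - y\<bar>" for x y
  proof -
    obtain v where "v \<in> {\<sigma>l..\<sigma>u}" "?g x = ?P v x" using step[where x = x] by metis
    moreover from this have "?P v y \<le> ?g y" using step[where x = y] by metis
    ultimately show ?thesis using bdd_lipD(2)[OF avg, of v x y] by linarith
  qed
  have "\<bar>?g x - ?g y\<bar> \<le> L * \<bar>x - y\<bar>" for x y
    using le[of x y] le[of y x] by (simp add: abs_le_iff abs_minus_commute)
  moreover have "\<bar>?g x\<bar> \<le> B" for x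
    using step[where x = x] bdd_lipD(1)[OF avg] by metis
  ultimately show ?case unfolding bdd_lip_def by blast
qed (use \<phi> in simp)

lemma viscosity_subsolution_le_phi_scheme:
  assumes \<sigma>: "0 \<le> \<sigma>l" "\<sigma>l \<le> \<sigma>u"
    and u: "continuous_on ({0..1} \<times> UNIV) (\<lambda>(t, x). u t x)" "viscosity_subsolution (G_fun \<sigma>l \<sigma>u) u"
    and u_bdd: "\<And>t x. 0 \<le> t \<Longrightarrow> t \<le> 1 \<Longrightarrow> u t x \<le> B"
    and \<phi>: "bdd_lip B L \<phi>" and u1: "\<And>x. u 1 x = \<phi> x" and e: "0 < e"
  shows "\<forall>\<^sub>F n in sequentially. u 0 x \<le> phi_scheme \<sigma>l \<sigma>u \<phi> n n x + e"
proof -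
  have L: "0 \<le> L" by (rule bdd_lip_nonneg[OF \<phi>])
  obtain \<epsilon> where \<epsilon>: "0 < \<epsilon>" and
    ev: "\<forall>\<^sub>F n in sequentially. 4 * L * \<epsilon> + 2 * L * \<sigma>u ^ 3 / \<epsilon>\<^sup>2 * sqrt (1 / real n) * 1 < e"
    using chain_error_small[OF e L] by blast
  show ?thesis
    using ev eventually_gt_at_top[of 0]
  proof eventually_elim
    case (elim n)
    let ?v = "phi_scheme \<sigma>l \<sigma>u \<phi> n"
    have v: "bdd_lip B L (?v k)" for k by (rule phi_scheme_bdd_lip[OF \<phi> \<sigma>])
    note step = phi_scheme_step[OF bdd_lip_exp_lip[OF v] \<sigma>]
    have "u 0 x \<le> ?v n x + 4 * L * \<epsilon> + 2 * L * \<sigma>u ^ 3 / \<epsilon>\<^sup>2 * sqrt (1 / real n) * (1 - 0)"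
    proof (rule viscosity_subsolution_le_chain[where v = ?v and \<delta> = "1 / real n", OF _ _ _ \<sigma> \<epsilon> elim(2) _ u u_bdd])
      show "u 1 x \<le> ?v 0 x" for x by (simp add: u1)
      show "bdd_lip B L (?v k)" for k by (rule v)
      show "avg std_normal_distribution (\<sigma> * sqrt (1 / real n)) (?v k) x \<le> ?v (Suc k) x"
        if "\<sigma> \<in> {\<sigma>l..\<sigma>u}" for k \<sigma> x
        using step[where x = x and i = k] that by (metis real_sqrt_divide real_sqrt_one times_divide_eq_right mult.right_neutral)
      show "\<bar>?v (Suc k) x - ?v k x\<bar> \<le> L * (\<sigma>u * sqrt (1 / real n))" for k x
      proof -
        obtain w where w: "w \<in> {\<sigma>l..\<sigma>u}" "?v (Suc k) x = avg std_normal_distribution (w / sqrt n) (?v k) x"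
          using step[where x = x and i = k] by metis
        have "\<bar>?v (Suc k) x - ?v k x\<bar> \<le> L * \<bar>w / sqrt n\<bar>"
          unfolding w(2) by (rule std_normal.avg_near[OF v std_normal_abs])
        also have "\<dots> \<le> L * (\<sigma>u * sqrt (1 / real n))"
          using w(1) \<sigma> L by (intro mult_left_mono) (auto simp: real_sqrt_divide divide_right_mono)
        finally show ?thesis .
      qed
    qed auto
    then show ?case using elim(1) by simp
  qed
qed

lemma phi_scheme_le_viscosity_supersolution:
  assumes \<sigma>: "0 \<le> \<sigma>l" "\<sigma>l \<le> \<sigma>u"
    and u: "continuous_on ({0..1} \<times> UNIV) (\<lambda>(t, x). u t x)" "viscosity_supersolution (G_fun \<sigma>l \<sigma>u) u"
    and u_lip: "\<And>t. 0 \<le> t \<Longrightarrow> t \<le> 1 \<Longrightarrow> bdd_lip B L (u t)"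
    and u1: "u 1 = \<phi>" and n: "0 < n"
  shows "phi_scheme \<sigma>l \<sigma>u \<phi> n n x \<le> u 0 x"
proof -
  have \<phi>: "bdd_lip B L \<phi>" using u_lip[of 1] u1 by simp
  have "phi_scheme \<sigma>l \<sigma>u \<phi> n i x \<le> u (1 - real i / real n) x" if "i \<le> n" for i x
    using that
  proof (induction i arbitrary: x)
    case 0
    then show ?case by (simp add: u1)
  next
    case (Suc i)
    let ?f = "phi_scheme \<sigma>l \<sigma>u \<phi> n i" and ?a = "1 - real (Suc i) / real n" and ?b = "1 - real i / real n"
    have ab: "0 \<le> ?a" "?a < ?b" "?b \<le> 1" "?b - ?a = 1 / real n"
      using Suc.prems n by (auto simp: field_simps)
    have f: "bdd_lip B L ?f" by (rule phi_scheme_bdd_lip[OF \<phi> \<sigma>])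
    have ub: "bdd_lip B L (u ?b)" using ab by (intro u_lip) linarith+
    \<comment> \<open>With the maximizer at \<open>x\<close> fixed, the step is a single Gaussian
      average: the induction hypothesis passes through it by monotonicity, and u dominates it over
      one time step.\<close>
    obtain v where v: "v \<in> {\<sigma>l..\<sigma>u}"
      "phi_scheme \<sigma>l \<sigma>u \<phi> n (Suc i) x = avg std_normal_distribution (v / sqrt n) ?f x"
      using phi_scheme_step[OF bdd_lip_exp_lip[OF f] \<sigma>] by metis
    note v(2)
    also have "avg std_normal_distribution (v / sqrt n) ?f x \<le> avg std_normal_distribution (v / sqrt n) (u ?b) x"
      using Suc.prems by (intro std_normal.avg_mono[OF f ub] Suc.IH) auto
    also have "v / sqrt n = v * sqrt (?b - ?a)" unfolding ab(4) by (simp add: real_sqrt_divide)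
    also have "avg std_normal_distribution (v * sqrt (?b - ?a)) (u ?b) x \<le> u ?a x"
    proof (rule viscosity_supersolution_ge_avg[OF ab(1-3) \<sigma>(1) v(1) _ u(2) _ ub])
      show "continuous_on ({?a..?b} \<times> UNIV) (\<lambda>(t, x). u t x)"
        by (rule continuous_on_subset[OF u(1)], rule Sigma_mono) (use ab in \<open>simp_all only: atLeastatMost_subset_iff subset_refl simp_thms\<close>)
      show "\<bar>u t x\<bar> \<le> B" if "?a \<le> t" "t \<le> ?b" for t x
        using ab that by (intro bdd_lipD(1)[OF u_lip]) linarith+
    qed
    finally show ?case .
  qed
  from this[of n x] show ?thesis using n by simp
qed

section \<open>Convergence\<close>

lemma lipschitz_C_lLip:
  assumes "\<And>x y. \<bar>f x - f y\<bar> \<le> L * \<bar>x - y\<bar>"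
  shows "f \<in> C_lLip"
proof -
  have L: "0 \<le> L" using assms[of 1 0] by simp
  \<comment> \<open>\<open>C_lLip\<close> asks for a positive constant, and L may be 0.\<close>
  have "\<bar>f x - f y\<bar> \<le> (L + 1) * (1 + \<bar>x\<bar> ^ 0 + \<bar>y\<bar> ^ 0) * \<bar>x - y\<bar>" for x y
  proof -
    have "L * \<bar>x - y\<bar> \<le> (L + 1) * (1 + \<bar>x\<bar> ^ 0 + \<bar>y\<bar> ^ 0) * \<bar>x - y\<bar>"
      using L by (intro mult_right_mono) auto
    then show ?thesis using assms[of x y] by linarith
  qed
  moreover have "0 < L + 1" using L by simp
  ultimately show ?thesis unfolding C_lLip_def by blast
qed

text \<open>In the factorization of a^(m+1) - b^(m+1) each of the m + 1 summands is at most max a b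
  ^ m.\<close>

lemma power_diff_le:
  fixes a b :: real
  assumes "0 \<le> a" "0 \<le> b"
  shows "\<bar>a ^ Suc m - b ^ Suc m\<bar> \<le> real (Suc m) * (a ^ m + b ^ m) * \<bar>a - b\<bar>"
proof -
  have "b ^ (Suc m - Suc i) * a ^ i \<le> a ^ m + b ^ m" if "i < Suc m" for i
  proof -
    let ?c = "max a b"
    have "b ^ (m - i) * a ^ i \<le> ?c ^ (m - i) * ?c ^ i"
      using assms by (intro mult_mono power_mono) auto
    also have "\<dots> = ?c ^ m" using that by (simp flip: power_add)
    also have "\<dots> \<le> a ^ m + b ^ m" using assms by (simp add: max_def)
    finally show ?thesis by simp
  qed
  then have "(\<Sum>i<Suc m. b ^ (Suc m - Suc i) * a ^ i) \<le> of_nat (card {..<Suc m}) * (a ^ m + b ^ m)"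
    by (intro sum_bounded_above) auto
  moreover have "0 \<le> (\<Sum>i<Suc m. b ^ (Suc m - Suc i) * a ^ i)"
    using assms by (intro sum_nonneg) auto
  ultimately have "\<bar>\<Sum>i<Suc m. b ^ (Suc m - Suc i) * a ^ i\<bar> * \<bar>a - b\<bar> \<le> real (Suc m) * (a ^ m + b ^ m) * \<bar>a - b\<bar>"
    by (intro mult_right_mono) auto
  then show ?thesis
    unfolding power_diff_sumr2 abs_mult by (simp only: mult.commute)
qed

text \<open>Places the powers of |X|, which control the truncation error, in
  \<open>\<H>\<close>.\<close>

lemma abs_power_C_lLip: "(\<lambda>x. \<bar>x\<bar> ^ Suc m) \<in> C_lLip"
proof -
  have "\<bar>\<bar>x\<bar> ^ Suc m - \<bar>y\<bar> ^ Suc m\<bar> \<le> real (Suc m) * (1 + \<bar>x\<bar> ^ m + \<bar>y\<bar> ^ m) * \<bar>x - y\<bar>" for x y :: real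
  proof -
    have "\<bar>\<bar>x\<bar> ^ Suc m - \<bar>y\<bar> ^ Suc m\<bar> \<le> real (Suc m) * (\<bar>x\<bar> ^ m + \<bar>y\<bar> ^ m) * \<bar>\<bar>x\<bar> - \<bar>y\<bar>\<bar>"
      by (rule power_diff_le) auto
    also have "\<dots> \<le> real (Suc m) * (1 + \<bar>x\<bar> ^ m + \<bar>y\<bar> ^ m) * \<bar>x - y\<bar>"
      by (intro mult_mono mult_left_mono) (auto simp: abs_triangle_ineq3)
    finally show ?thesis .
  qed
  then show ?thesis unfolding C_lLip_def by (intro CollectI exI[of _ "real (Suc m)"] conjI exI[of _ m] allI) auto
qed

context sublinear_expectation_space
begin

lemma comp_mem:
  assumes "X \<in> \<H>" "g \<in> C_lLip"
  shows "(\<lambda>\<omega>. g (X \<omega>)) \<in> \<H>"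
  using lLip_mem[of 1 "\<lambda>_. X" "\<lambda>x. g (x 0)"] assms C_lLip_dim_1[of g] by simp

lemma expectation_le_add:
  assumes "Y \<in> \<H>" "Z \<in> \<H>" "W \<in> \<H>" "\<And>\<omega>. Y \<omega> \<le> Z \<omega> + W \<omega>"
  shows "\<E> Y \<le> \<E> Z + \<E> W"
  using mono[OF assms(1) add_mem[OF assms(2,3)] assms(4)] subadd[OF assms(2,3)] by simp

text \<open>The regularity of u in x comes from its representation by \<open>\<E>\<close> and not
  from the equation: every time slice inherits the constants of the data, whatever the scale
  \<open>s\<close>.\<close>

lemma expectation_bdd_lip:
  assumes X: "X \<in> \<H>" and \<phi>: "bdd_lip B L \<phi>"
  shows "bdd_lip B L (\<lambda>x. \<E> (\<lambda>\<omega>. \<phi> (x + s * X \<omega>)))"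
proof -
  have mem: "(\<lambda>\<omega>. \<phi> (x + s * X \<omega>)) \<in> \<H>" for x
  proof (rule comp_mem[OF X], rule lipschitz_C_lLip)
    show "\<bar>\<phi> (x + s * y) - \<phi> (x + s * z)\<bar> \<le> L * \<bar>s\<bar> * \<bar>y - z\<bar>" for y z
      using bdd_lipD(2)[OF \<phi>, of "x + s * y" "x + s * z"]
      by (simp add: mult.assoc flip: abs_mult right_diff_distrib)
  qed
  have "\<E> (\<lambda>\<omega>. \<phi> (x + s * X \<omega>)) \<le> B" "- B \<le> \<E> (\<lambda>\<omega>. \<phi> (x + s * X \<omega>))" for x
    using mono[OF mem const_mem[of B], of x] mono[OF const_mem[of "- B"] mem, of x] bdd_lipD(1)[OF \<phi>]
    by (auto simp: const abs_le_iff minus_le_iff)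
  moreover have le: "\<E> (\<lambda>\<omega>. \<phi> (x + s * X \<omega>)) \<le> \<E> (\<lambda>\<omega>. \<phi> (y + s * X \<omega>)) + L * \<bar>x - y\<bar>" for x y
  proof -
    have "\<phi> (x + s * X \<omega>) \<le> \<phi> (y + s * X \<omega>) + L * \<bar>x - y\<bar>" for \<omega>
      using bdd_lipD(2)[OF \<phi>, of "x + s * X \<omega>" "y + s * X \<omega>"] by simp
    from expectation_le_add[OF mem mem const_mem this] show ?thesis by (simp add: const)
  qed
  moreover have "\<bar>\<E> (\<lambda>\<omega>. \<phi> (x + s * X \<omega>)) - \<E> (\<lambda>\<omega>. \<phi> (y + s * X \<omega>))\<bar> \<le> L * \<bar>x - y\<bar>" for x y
    using le[of x y] le[of y x] by (simp add: abs_le_iff abs_minus_commute)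
  ultimately show ?thesis by (auto simp: bdd_lip_def abs_le_iff minus_le_iff)
qed

lemma phi_scheme_tendsto_of_bdd_lip:
  assumes \<sigma>: "0 \<le> \<sigma>l" "\<sigma>l \<le> \<sigma>u" and X: "G_normal \<H> \<E> \<sigma>l \<sigma>u X" and \<phi>: "bdd_lip B L \<phi>"
  shows "(\<lambda>n. phi_scheme \<sigma>l \<sigma>u \<phi> n n 0) \<longlonglongrightarrow> \<E> (\<lambda>\<omega>. \<phi> (X \<omega>))"
proof -
  define u where "u = (\<lambda>t x. \<E> (\<lambda>\<omega>. \<phi> (x + sqrt (1 - t) * X \<omega>)))"
  have "\<phi> \<in> C_lLip" by (rule lipschitz_C_lLip[OF bdd_lipD(2)[OF \<phi>]])
  with X have "G_heat_solution (G_fun \<sigma>l \<sigma>u) \<phi> u" and mem: "X \<in> \<H>"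
    unfolding G_normal_def u_def by auto
  then have u: "continuous_on ({0..1} \<times> UNIV) (\<lambda>(t, x). u t x)"
    "viscosity_subsolution (G_fun \<sigma>l \<sigma>u) u" "viscosity_supersolution (G_fun \<sigma>l \<sigma>u) u" "\<And>x. u 1 x = \<phi> x"
    unfolding G_heat_solution_def by auto
  have u_lip: "bdd_lip B L (u t)" for t
    unfolding u_def by (rule expectation_bdd_lip[OF mem \<phi>])
  have u0: "u 0 0 = \<E> (\<lambda>\<omega>. \<phi> (X \<omega>))" by (simp add: u_def)
  have lower: "phi_scheme \<sigma>l \<sigma>u \<phi> n n 0 \<le> u 0 0" if "0 < n" for n
    by (rule phi_scheme_le_viscosity_supersolution[OF \<sigma> u(1,3) u_lip _ that]) (use u(4) in auto)
  have upper: "\<forall>\<^sub>F n in sequentially. u 0 0 \<le> phi_scheme \<sigma>l \<sigma>u \<phi> n n 0 + e" if "0 < e" for e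
    using abs_le_D1[OF bdd_lipD(1)[OF u_lip]]
    by (intro viscosity_subsolution_le_phi_scheme[OF \<sigma> u(1,2) _ \<phi> u(4) that]) auto
  show ?thesis
    unfolding u0[symmetric]
  proof (rule tendstoI)
    fix e :: real assume "0 < e"
    then have "\<forall>\<^sub>F n in sequentially. u 0 0 \<le> phi_scheme \<sigma>l \<sigma>u \<phi> n n 0 + e / 2" by (intro upper) simp
    with eventually_gt_at_top[of 0] show "\<forall>\<^sub>F n in sequentially. dist (phi_scheme \<sigma>l \<sigma>u \<phi> n n 0) (u 0 0) < e"
    proof eventually_elim
      case (elim n)
      then show ?case using lower[of n] \<open>0 < e\<close> by (simp add: dist_real_def abs_if)
    qed
  qed
qed

end

section \<open>Truncation of data of polynomial growth\<close>

lemma avg_cosh: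
  "integrable std_normal_distribution (\<lambda>z. exp (x + s * z) + exp (- (x + s * z)))"
  "avg std_normal_distribution s (\<lambda>x. exp x + exp (- x)) x = exp (s\<^sup>2 / 2) * (exp x + exp (- x))"
proof -
  have eq: "exp (x + s * z) + exp (- (x + s * z)) = exp x * exp (s * z) + exp (- x) * exp (- s * z)" for z
    by (simp flip: exp_add)
  have i: "integrable std_normal_distribution (\<lambda>z. exp x * exp (s * z))"
    "integrable std_normal_distribution (\<lambda>z. exp (- x) * exp (- s * z))"
    by (intro integrable_mult_right std_normal_exp_integrable)+
  show "integrable std_normal_distribution (\<lambda>z. exp (x + s * z) + exp (- (x + s * z)))"
    unfolding eq by (intro Bochner_Integration.integrable_add i)
  show "avg std_normal_distribution s (\<lambda>x. exp x + exp (- x)) x = exp (s\<^sup>2 / 2) * (exp x + exp (- x))"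
    unfolding avg_def eq Bochner_Integration.integral_add[OF i] integral_mult_right_zero std_normal_exp_integral
    by (simp add: algebra_simps)
qed

text \<open>
  A deviation of the terminal data by a multiple of \<open>exp x + exp (- x)\<close>, an eigenfunction of every
  Gaussian average, is amplified by the whole scheme by a factor bounded independently of \<open>n\<close>.
\<close>

lemma phi_scheme_le_add_cosh:
  assumes \<sigma>: "0 \<le> \<sigma>l" "\<sigma>l \<le> \<sigma>u" and D: "0 \<le> D"
    and \<phi>: "exp_lip C \<phi>" and \<psi>: "exp_lip C' \<psi>" and le: "\<And>x. \<phi> x \<le> \<psi> x + D * (exp x + exp (- x))"
  shows "phi_scheme \<sigma>l \<sigma>u \<phi> n i x \<le> phi_scheme \<sigma>l \<sigma>u \<psi> n i x + D * exp (real i * (\<sigma>u\<^sup>2 / n / 2)) * (exp x + exp (- x))"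
proof (induction i arbitrary: x)
  case 0
  then show ?case using le by simp
next
  case (Suc i)
  let ?f = "phi_scheme \<sigma>l \<sigma>u \<phi> n i" and ?g = "phi_scheme \<sigma>l \<sigma>u \<psi> n i"
  let ?K = "D * exp (real i * (\<sigma>u\<^sup>2 / n / 2))"
  obtain Cf where f: "exp_lip Cf ?f" using phi_scheme_exp_lip[OF \<phi> \<sigma>] by blast
  obtain Cg where g: "exp_lip Cg ?g" using phi_scheme_exp_lip[OF \<psi> \<sigma>] by blast
  obtain v where v: "v \<in> {\<sigma>l..\<sigma>u}"
    "phi_scheme \<sigma>l \<sigma>u \<phi> n (Suc i) x = avg std_normal_distribution (v / sqrt n) ?f x"
    using phi_scheme_step[OF f \<sigma>] by metis
  let ?s = "v / sqrt n"
  note v(2)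
  also have "avg std_normal_distribution ?s ?f x \<le>
      (LINT z|std_normal_distribution. ?g (x + ?s * z) + ?K * (exp (x + ?s * z) + exp (- (x + ?s * z))))"
    unfolding avg_def
    by (intro integral_mono Bochner_Integration.integrable_add integrable_mult_right exp_lip_integrable[OF f]
        exp_lip_integrable[OF g] avg_cosh(1) Suc.IH)
  also have "\<dots> = avg std_normal_distribution ?s ?g x + ?K * (exp (?s\<^sup>2 / 2) * (exp x + exp (- x)))"
    unfolding avg_cosh(2)[symmetric] avg_def
    by (subst Bochner_Integration.integral_add)
       (intro integrable_mult_right exp_lip_integrable[OF g] avg_cosh(1) refl integral_mult_right_zero arg_cong2[where f = "(+)"])+
  also have "avg std_normal_distribution ?s ?g x \<le> phi_scheme \<sigma>l \<sigma>u \<psi> n (Suc i) x"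
    using phi_scheme_step[OF g \<sigma>] v(1) by metis
  also have "?K * (exp (?s\<^sup>2 / 2) * (exp x + exp (- x))) \<le> ?K * (exp (\<sigma>u\<^sup>2 / n / 2) * (exp x + exp (- x)))"
  proof -
    have "v\<^sup>2 \<le> \<sigma>u\<^sup>2" using v(1) \<sigma> by (intro power_mono) auto
    then have "?s\<^sup>2 \<le> \<sigma>u\<^sup>2 / n" by (simp add: power_divide divide_right_mono)
    then show ?thesis using D by (intro mult_left_mono mult_right_mono) (auto intro: add_nonneg_nonneg)
  qed
  also have "?K * (exp (\<sigma>u\<^sup>2 / n / 2) * (exp x + exp (- x))) =
      D * exp (real (Suc i) * (\<sigma>u\<^sup>2 / n / 2)) * (exp x + exp (- x))"
  proof -
    have "exp (real (Suc i) * c) = exp (real i * c) * exp c" for c :: real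
      by (simp add: algebra_simps flip: exp_add)
    then show ?thesis by (simp only: mult.assoc)
  qed
  finally show ?case by simp
qed

text \<open>The argument is clamped and not the value: this cuts off the growth of the local
  Lipschitz constant together with that of the function.\<close>

definition clamp_fun :: "real \<Rightarrow> (real \<Rightarrow> real) \<Rightarrow> real \<Rightarrow> real" where
  "clamp_fun R f x = f (max (- R) (min R x))"

lemma clamp_fun_bdd_lip:
  assumes R: "0 \<le> R" and C: "0 \<le> C" and b: "\<And>x y. \<bar>f x - f y\<bar> \<le> C * (1 + \<bar>x\<bar> ^ k + \<bar>y\<bar> ^ k) * \<bar>x - y\<bar>"
  obtains B L where "bdd_lip B L (clamp_fun R f)"
proof
  define c where "c = (\<lambda>x. max (- R) (min R x))"
  have clamp: "clamp_fun R f x = f (c x)" for x by (simp add: clamp_fun_def c_def)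
  have c_le: "\<bar>c x\<bar> \<le> R" and c_lip: "\<bar>c x - c y\<bar> \<le> \<bar>x - y\<bar>" for x y
    using R by (auto simp: c_def)
  have p: "\<bar>c x\<bar> ^ k \<le> R ^ k" for x by (intro power_mono c_le) auto
  have lip: "\<bar>clamp_fun R f x - clamp_fun R f y\<bar> \<le> C * (1 + R ^ k + R ^ k) * \<bar>x - y\<bar>" for x y
  proof -
    have "C * (1 + \<bar>c x\<bar> ^ k + \<bar>c y\<bar> ^ k) * \<bar>c x - c y\<bar> \<le> C * (1 + R ^ k + R ^ k) * \<bar>x - y\<bar>"
      using C R by (intro mult_mono mult_left_mono add_mono p c_lip) auto
    then show ?thesis unfolding clamp using b[of "c x" "c y"] by linarith
  qed
  have "\<bar>clamp_fun R f x\<bar> \<le> \<bar>f 0\<bar> + C * (1 + R ^ k + \<bar>0\<bar> ^ k) * R" for x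
  proof -
    have "C * (1 + \<bar>c x\<bar> ^ k + \<bar>0\<bar> ^ k) * \<bar>c x - 0\<bar> \<le> C * (1 + R ^ k + \<bar>0\<bar> ^ k) * R"
      using C R c_le[of x] by (intro mult_mono mult_left_mono add_mono p) auto
    then show ?thesis unfolding clamp using b[of "c x" 0] by linarith
  qed
  with lip show "bdd_lip (\<bar>f 0\<bar> + C * (1 + R ^ k + \<bar>0\<bar> ^ k) * R) (C * (1 + R ^ k + R ^ k)) (clamp_fun R f)"
    unfolding bdd_lip_def by blast
qed

text \<open>Clamping moves x only when |x| > R, and then by at most |x| \<le> |x|^2 / R. One extra
  power of |x| buys the factor 1 / R.\<close>

lemma clamp_fun_dist:
  assumes R: "0 < R" and C: "0 \<le> C" and b: "\<And>x y. \<bar>f x - f y\<bar> \<le> C * (1 + \<bar>x\<bar> ^ k + \<bar>y\<bar> ^ k) * \<bar>x - y\<bar>"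
  shows "\<bar>f x - clamp_fun R f x\<bar> \<le> C / R * (\<bar>x\<bar>\<^sup>2 + 2 * \<bar>x\<bar> ^ (k + 2))"
proof -
  let ?c = "max (- R) (min R x)"
  have "\<bar>?c\<bar> \<le> \<bar>x\<bar>" using R by auto
  then have p: "\<bar>?c\<bar> ^ k \<le> \<bar>x\<bar> ^ k" by (intro power_mono) auto
  have d: "\<bar>x - ?c\<bar> \<le> \<bar>x\<bar>\<^sup>2 / R"
  proof (cases "\<bar>x\<bar> \<le> R")
    case True
    then show ?thesis using R by (auto simp: max_def min_def)
  next
    case False
    then have "\<bar>x - ?c\<bar> \<le> \<bar>x\<bar>" using R by auto
    also have "\<dots> * R \<le> \<bar>x\<bar> * \<bar>x\<bar>" using False by (intro mult_left_mono) auto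
    finally show ?thesis using R by (simp add: pos_le_divide_eq power2_eq_square)
  qed
  have "\<bar>f x - clamp_fun R f x\<bar> \<le> C * (1 + \<bar>x\<bar> ^ k + \<bar>?c\<bar> ^ k) * \<bar>x - ?c\<bar>"
    unfolding clamp_fun_def by (rule b)
  also have "\<dots> \<le> C * (1 + \<bar>x\<bar> ^ k + \<bar>x\<bar> ^ k) * (\<bar>x\<bar>\<^sup>2 / R)"
    using C p d by (intro mult_mono mult_left_mono) auto
  also have "\<dots> = C / R * (\<bar>x\<bar>\<^sup>2 + 2 * \<bar>x\<bar> ^ (k + 2))"
  proof -
    have "C * (1 + P + P) * (Q / R) = C / R * (Q + 2 * (P * Q))" for P Q
      using R by (simp add: field_simps)
    then show ?thesis by (simp only: power_add)
  qed
  finally show ?thesis .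
qed

text \<open>Passes from the polynomial weight of the truncation error to the weight that the scheme
  propagates.\<close>

lemma moment_le_cosh: "\<bar>x\<bar>\<^sup>2 + 2 * \<bar>x\<bar> ^ (k + 2) \<le> (2 + 2 * fact (k + 2)) * (exp x + exp (- x :: real))"
proof -
  have "exp \<bar>x\<bar> \<le> exp x + exp (- x)" by (auto simp: abs_if)
  then have "(2 + 2 * fact (k + 2)) * exp \<bar>x\<bar> \<le> (2 + 2 * fact (k + 2)) * (exp x + exp (- x))"
    by (intro mult_left_mono) auto
  then show ?thesis
    using power_le_exp[of "\<bar>x\<bar>" 2] power_le_exp[of "\<bar>x\<bar>" "k + 2"] by (simp add: distrib_right del: fact_Suc)
qed

theorem theorem3p4:
  fixes \<H> :: "('w \<Rightarrow> real) set"
    and \<E> :: "('w \<Rightarrow> real) \<Rightarrow> real"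
    and X :: "'w \<Rightarrow> real"
    and \<phi> :: "real \<Rightarrow> real"
    and \<sigma>l \<sigma>u :: real
  assumes "sublinear_expectation_space \<H> \<E>"
    and "0 \<le> \<sigma>l" and "\<sigma>l \<le> \<sigma>u"
    and "G_normal \<H> \<E> \<sigma>l \<sigma>u X"
    and "\<phi> \<in> C_lLip"
  shows "(\<lambda>n. phi_scheme \<sigma>l \<sigma>u \<phi> n n 0) \<longlonglongrightarrow> \<E> (\<lambda>\<omega>. \<phi> (X \<omega>))"
proof (rule tendstoI)
  interpret sublinear_expectation_space \<H> \<E> by fact
  fix e :: real assume e: "0 < e"
  note \<sigma> = assms(2,3)
  have X: "X \<in> \<H>" using assms(4) by (simp add: G_normal_def)
  obtain C k where C: "0 < C"
    and b: "\<And>x y. \<bar>\<phi> x - \<phi> y\<bar> \<le> C * (1 + \<bar>x\<bar> ^ k + \<bar>y\<bar> ^ k) * \<bar>x - y\<bar>"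
    using assms(5) by (auto simp: C_lLip_def)
  define q where "q = (\<lambda>\<omega>. \<bar>X \<omega>\<bar>\<^sup>2 + 2 * \<bar>X \<omega>\<bar> ^ (k + 2))"
  have q: "q \<in> \<H>"
    using add_mem[OF comp_mem[OF X abs_power_C_lLip[of 1]] scale_mem[OF comp_mem[OF X abs_power_C_lLip[of "k + 1"]], of 2]]
    by (simp add: q_def numeral_2_eq_2)
  \<comment> \<open>The first summand serves the scheme at x = 0: the factor 2 is exp 0 + exp (- 0),
    and exp (\<sigma>u^2 / 2) is the amplification over all n steps. The second serves
    \<open>\<E>\<close>. Thus D / R bounds both truncation errors.\<close>
  define D where "D = 2 * (C * (2 + 2 * fact (k + 2))) * exp (\<sigma>u\<^sup>2 / 2) + C * \<bar>\<E> q\<bar>"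
  have D: "0 \<le> D" using C by (simp add: D_def)
  \<comment> \<open>Makes D / R smaller than e / 3; the summand 1 keeps \<open>R\<close> positive
    when \<open>D = 0\<close>. The other two thirds go to the second truncation error and to the
    convergence for the truncated data.\<close>
  define R where "R = 1 + 3 * D / e"
  have R: "0 < R" using D e by (simp add: R_def add_pos_nonneg)
  have small: "D / R < e / 3" using D e R by (simp add: R_def field_simps)
  define \<psi> where "\<psi> = clamp_fun R \<phi>"
  obtain B L where \<psi>: "bdd_lip B L \<psi>"
    unfolding \<psi>_def using clamp_fun_bdd_lip[OF less_imp_le[OF R] less_imp_le[OF C] b] by blast
  have dist: "\<bar>\<phi> x - \<psi> x\<bar> \<le> C / R * (\<bar>x\<bar>\<^sup>2 + 2 * \<bar>x\<bar> ^ (k + 2))" for x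
    unfolding \<psi>_def by (rule clamp_fun_dist[OF R less_imp_le[OF C] b])
  obtain C\<phi> where \<phi>: "exp_lip C\<phi> \<phi>" using C_lLip_exp_lip[OF assms(5)] by blast
  have scheme: "\<bar>phi_scheme \<sigma>l \<sigma>u \<phi> n n 0 - phi_scheme \<sigma>l \<sigma>u \<psi> n n 0\<bar> \<le> D / R" if n: "0 < n" for n
  proof -
    let ?D = "C / R * (2 + 2 * fact (k + 2))"
    have D': "0 \<le> ?D" using C R by simp
    have "\<bar>\<phi> x - \<psi> x\<bar> \<le> ?D * (exp x + exp (- x))" for x
      using order_trans[OF dist mult_left_mono[OF moment_le_cosh]] C R by (simp add: mult.assoc)
    then have le: "\<phi> x \<le> \<psi> x + ?D * (exp x + exp (- x))" "\<psi> x \<le> \<phi> x + ?D * (exp x + exp (- x))" for x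
      by (simp_all add: abs_le_iff algebra_simps)
    have "\<bar>phi_scheme \<sigma>l \<sigma>u \<phi> n n 0 - phi_scheme \<sigma>l \<sigma>u \<psi> n n 0\<bar> \<le> ?D * exp (real n * (\<sigma>u\<^sup>2 / n / 2)) * (exp 0 + exp (- 0))"
      using phi_scheme_le_add_cosh[OF \<sigma> D' \<phi> bdd_lip_exp_lip[OF \<psi>] le(1), of n n 0]
        phi_scheme_le_add_cosh[OF \<sigma> D' bdd_lip_exp_lip[OF \<psi>] \<phi> le(2), of n n 0] by linarith
    also have "\<dots> = (2 * (C * (2 + 2 * fact (k + 2))) * exp (\<sigma>u\<^sup>2 / 2)) / R"
      using n by (simp del: fact_Suc)
    also have "\<dots> \<le> D / R" unfolding D_def using R C by (intro divide_right_mono) auto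
    finally show ?thesis .
  qed
  have exp: "\<bar>\<E> (\<lambda>\<omega>. \<phi> (X \<omega>)) - \<E> (\<lambda>\<omega>. \<psi> (X \<omega>))\<bar> \<le> D / R"
  proof -
    have mem: "(\<lambda>\<omega>. \<phi> (X \<omega>)) \<in> \<H>" "(\<lambda>\<omega>. \<psi> (X \<omega>)) \<in> \<H>"
      by (rule comp_mem[OF X assms(5)], rule comp_mem[OF X lipschitz_C_lLip[OF bdd_lipD(2)[OF \<psi>]]])
    have "\<phi> (X \<omega>) \<le> \<psi> (X \<omega>) + C / R * q \<omega>" "\<psi> (X \<omega>) \<le> \<phi> (X \<omega>) + C / R * q \<omega>" for \<omega>
      using dist[of "X \<omega>"] by (simp_all add: q_def abs_le_iff)
    then have "\<bar>\<E> (\<lambda>\<omega>. \<phi> (X \<omega>)) - \<E> (\<lambda>\<omega>. \<psi> (X \<omega>))\<bar> \<le> \<E> (\<lambda>\<omega>. C / R * q \<omega>)"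
      using expectation_le_add[OF mem scale_mem[OF q, of "C / R"]] expectation_le_add[OF mem(2,1) scale_mem[OF q, of "C / R"]]
      by (simp only: abs_le_iff diff_le_eq minus_diff_eq add.commute)
    also have "\<dots> = C * \<E> q / R" using pos_homog[OF q, of "C / R"] C R by simp
    also have "\<dots> \<le> D / R"
    proof (rule divide_right_mono)
      have "C * \<E> q \<le> C * \<bar>\<E> q\<bar>" using C by (intro mult_left_mono) auto
      also have "\<dots> \<le> D" unfolding D_def using C by simp
      finally show "C * \<E> q \<le> D" .
    qed (use R in simp)
    finally show ?thesis .
  qed
  have "\<forall>\<^sub>F n in sequentially. dist (phi_scheme \<sigma>l \<sigma>u \<psi> n n 0) (\<E> (\<lambda>\<omega>. \<psi> (X \<omega>))) < e / 3"
    using tendstoD[OF phi_scheme_tendsto_of_bdd_lip[OF \<sigma> assms(4) \<psi>], of "e / 3"] e by simp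
  with eventually_gt_at_top[of 0]
  show "\<forall>\<^sub>F n in sequentially. dist (phi_scheme \<sigma>l \<sigma>u \<phi> n n 0) (\<E> (\<lambda>\<omega>. \<phi> (X \<omega>))) < e"
  proof eventually_elim
    case (elim n)
    then show ?case using scheme[OF elim(1)] exp small unfolding dist_real_def by linarith
  qed
qed

end
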